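(* Let $K$ be the ring of formal power series of bounded degree in $x_1,x_2,\dots$ with integer coefficients. Suppose $f\in\mathrm{QSym}$ and $f=\prod_i f_i$ is a factorization of $f$ into irreducible elements of $K$. Then $f_i\in\mathrm{QSym}$ for every $i$.
   Context: $\mathrm{QSym}\subseteq K$ is the subring of quasi-symmetric functions: $f\in K$ such that the coefficient of $x_{i_1}^{a_1}\cdots x_{i_k}^{a_k}$ equals that of $x_{j_1}^{a_1}\cdots x_{j_k}^{a_k}$ whenever $i_1<\dots<i_k$ and $j_1<\dots<j_k$ (for all positive $a_1,\dots,a_k$). The units of $K$ are $\pm1$. *)

theory Defs
  imports Main "HOL-Library.Poly_Mapping"
begin

text \<open>Monomials in the variables x_0, x_1, x_2, ... (index i stands for x_(i+1)) are
finitely supported exponent vectors poly_mapping nat nat.  An element of K is its coefficient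
function on monomials; K consists of those with bounded degree.\<close>

type_synonym monom = "nat \<Rightarrow>\<^sub>0 nat"
type_synonym series = "monom \<Rightarrow> int"

definition mdeg :: "monom \<Rightarrow> nat" where
  "mdeg m = (\<Sum>i\<in>Poly_Mapping.keys m. Poly_Mapping.lookup m i)"

definition K :: "series set" where
  "K = {f. \<exists>d. \<forall>m. f m \<noteq> 0 \<longrightarrow> mdeg m \<le> d}"

text \<open>Multiplication of power series (Cauchy product; each monomial has finitely many
factorisations m = a + b).\<close>
definition kmul :: "series \<Rightarrow> series \<Rightarrow> series" where
  "kmul f g = (\<lambda>m. \<Sum>p\<in>{(a, b). a + b = m}. f (fst p) * g (snd p))"

definition kone :: series where
  "kone = (\<lambda>m. if m = 0 then 1 else 0)"

definition kzero :: series where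
  "kzero = (\<lambda>m. 0)"

definition kprod :: "series list \<Rightarrow> series" where
  "kprod fs = foldr kmul fs kone"

definition K_unit :: "series \<Rightarrow> bool" where
  "K_unit u \<longleftrightarrow> u \<in> K \<and> (\<exists>v\<in>K. kmul u v = kone)"

definition K_irreducible :: "series \<Rightarrow> bool" where
  "K_irreducible p \<longleftrightarrow> p \<in> K \<and> p \<noteq> kzero \<and> \<not> K_unit p \<and>
     (\<forall>a\<in>K. \<forall>b\<in>K. p = kmul a b \<longrightarrow> K_unit a \<or> K_unit b)"

definition exps :: "monom \<Rightarrow> nat list" where
  "exps m = map (Poly_Mapping.lookup m) (sorted_list_of_set (Poly_Mapping.keys m))"

definition QSym :: "series set" where
  "QSym = {f \<in> K. \<forall>m m'. exps m = exps m' \<longrightarrow> f m = f m'}"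

end

theory Submission
  imports Defs "HOL-Computational_Algebra.Polynomial" "HOL-Computational_Algebra.Primes"
begin

text \<open>
  Setting one variable to zero and closing up the gap is a ring endomorphism \<open>shift j\<close> of K, and
  QSym consists of the common fixed points of all \<open>shift j\<close>.  Hence the shifted factors
  multiply to the same quasi-symmetric f as the original ones.  Truncated to sufficiently
  many variables, the irreducible factors become primes of the factorial ring
  \<open>\<int>[x\<^sub>0, \<dots>, x\<^sub>n\<^sub>-\<^sub>1]\<close>, so unique factorization shows that every \<open>shift j\<close> permutes the finite set X of
  the factors and their negatives.  For large j it fixes X pointwise, because the elements of X are
  separated by finitely many monomials; and \<open>shift j \<circ> shift (j + 1) = shift j \<circ> shift j\<close> together
  with injectivity on X carries this down to all j.

  An irreducible p of K has eventually prime truncations because the number of prime factors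
  of its truncations is eventually constant; from then on a prime factor can be lifted coherently
  from n to n + 1 variables, which in the limit gives a factor of p in K.
\<close>

section \<open>Relative divisibility and the Gauss lemma\<close>

text \<open>Unique factorization is used only in finitely many variables, and truncating to them has
  two obstacles. It may split an irreducible element or turn a nonunit into a unit, and a shifted
  factor is not known to be irreducible at all. Degrees settle the question of units: truncation and
  shift never raise a degree, while the degree of the product is unchanged, so no factor loses
  degree; and a factor of degree 0 is a constant, which neither operation changes. Counting settles
  irreducibility: if primes and equally many nonunits have the same product, then the nonunits are
  those primes up to units and order. So only one of the two sides has to consist of primes. The
  number n of variables varies inside the proofs, and whether a divides b or is a unit depends on
  the ring. All these rings are therefore carrier sets in one type, and the ring-theoretic notions
  are stated relative to a subset of an integral domain.\<close>

definition rdvd :: "'a::idom set \<Rightarrow> 'a \<Rightarrow> 'a \<Rightarrow> bool" where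
  "rdvd R a b \<longleftrightarrow> (\<exists>c\<in>R. b = a * c)"

definition runit :: "'a::idom set \<Rightarrow> 'a \<Rightarrow> bool" where
  "runit R u \<longleftrightarrow> u \<in> R \<and> rdvd R u 1"

definition rirreducible :: "'a::idom set \<Rightarrow> 'a \<Rightarrow> bool" where
  "rirreducible R p \<longleftrightarrow> p \<in> R \<and> p \<noteq> 0 \<and> \<not> runit R p \<and>
     (\<forall>a\<in>R. \<forall>b\<in>R. p = a * b \<longrightarrow> runit R a \<or> runit R b)"

definition rprime :: "'a::idom set \<Rightarrow> 'a \<Rightarrow> bool" where
  "rprime R p \<longleftrightarrow> p \<in> R \<and> p \<noteq> 0 \<and> \<not> runit R p \<and>
     (\<forall>a\<in>R. \<forall>b\<in>R. rdvd R p (a * b) \<longrightarrow> rdvd R p a \<or> rdvd R p b)"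

text \<open>The factors are required to be prime and not merely irreducible; uniqueness of the
  factorization is then a consequence, extracted below by distributing primes.\<close>

definition factorial_set :: "'a::idom set \<Rightarrow> bool" where
  "factorial_set R \<longleftrightarrow> (\<forall>a\<in>R. a \<noteq> 0 \<longrightarrow>
     (\<exists>u ps. runit R u \<and> (\<forall>p\<in>set ps. rprime R p) \<and> a = u * prod_list ps))"

definition polys_over :: "'a::idom set \<Rightarrow> 'a poly set" where
  "polys_over R = {p. \<forall>i. coeff p i \<in> R}"

lemma smult_left_cancel:
  fixes c :: "'a::idom" shows "c \<noteq> 0 \<Longrightarrow> smult c p = smult c q \<longleftrightarrow> p = q"
  by (simp add: poly_eq_iff)

locale subdomain =
  fixes R :: "'a::idom set"
  assumes one_mem [simp, intro]: "1 \<in> R"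
    and diff_mem [simp, intro]: "\<And>a b. a \<in> R \<Longrightarrow> b \<in> R \<Longrightarrow> a - b \<in> R"
    and mult_mem [simp, intro]: "\<And>a b. a \<in> R \<Longrightarrow> b \<in> R \<Longrightarrow> a * b \<in> R"
begin

lemma zero_mem [simp, intro]: "0 \<in> R"
  using diff_mem[OF one_mem one_mem] by simp

lemma uminus_mem [simp, intro]: "a \<in> R \<Longrightarrow> - a \<in> R"
  using diff_mem[OF zero_mem, of a] by simp

lemma add_mem [simp, intro]: "a \<in> R \<Longrightarrow> b \<in> R \<Longrightarrow> a + b \<in> R"
  using diff_mem[of a "- b"] by simp

lemma sum_mem: "(\<And>i. i \<in> I \<Longrightarrow> f i \<in> R) \<Longrightarrow> sum f I \<in> R"
  by (induction I rule: infinite_finite_induct) auto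

lemma runit_one [simp]: "runit R 1"
  by (auto simp: runit_def rdvd_def intro!: bexI[of _ 1])

lemma runit_mult_iff:
  assumes "a \<in> R" "b \<in> R"
  shows "runit R (a * b) \<longleftrightarrow> runit R a \<and> runit R b"
proof
  assume "runit R (a * b)"
  then obtain c where c: "c \<in> R" "1 = a * b * c"
    by (auto simp: runit_def rdvd_def)
  have "1 = a * (b * c)" "1 = b * (a * c)" using c(2) by (simp_all add: ac_simps)
  then show "runit R a \<and> runit R b"
    unfolding runit_def rdvd_def using assms c(1) by blast
next
  assume "runit R a \<and> runit R b"
  then obtain c d where "c \<in> R" "1 = a * c" "d \<in> R" "1 = b * d"
    by (auto simp: runit_def rdvd_def)
  then have "(a * c) * (b * d) = 1" "c * d \<in> R" by (simp_all flip: \<open>1 = a * c\<close> \<open>1 = b * d\<close>)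
  then have "1 = a * b * (c * d)" "c * d \<in> R" by (simp_all add: ac_simps)
  then show "runit R (a * b)" using assms by (auto simp: runit_def rdvd_def)
qed

lemma runit_inverse:
  assumes "runit R u" obtains v where "runit R v" "u * v = 1"
  using assms by (metis mult.commute rdvd_def runit_def)

lemma prod_list_mem: "set ps \<subseteq> R \<Longrightarrow> prod_list ps \<in> R"
  by (induction ps) auto

text \<open>The primes are dealt out one by one: each divides \<open>a\<close> or \<open>b\<close>
  and is cancelled there, until a product of two elements equal to a unit remains.\<close>

lemma prime_list_split:
  assumes "a \<in> R" "b \<in> R" "runit R u" "\<forall>p\<in>set ps. rprime R p" "a * b = u * prod_list ps"
  shows "\<exists>v w ps1 ps2. runit R v \<and> runit R w \<and> a = v * prod_list ps1 \<and> b = w * prod_list ps2 \<and>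
    set ps1 \<union> set ps2 = set ps \<and> length ps1 + length ps2 = length ps"
  using assms
proof (induction ps arbitrary: a b)
  case Nil
  then have "runit R a" "runit R b" using runit_mult_iff by auto
  then show ?case by (intro exI[of _ a] exI[of _ b] exI[of _ "[]"]) simp
next
  case (Cons p ps)
  have p: "rprime R p" using Cons.prems by simp
  have mem: "u * prod_list ps \<in> R"
    using Cons.prems by (intro mult_mem prod_list_mem) (auto simp: runit_def rprime_def)
  have "rdvd R p (a * b)" unfolding rdvd_def using mem Cons.prems(5) by (auto simp: ac_simps)
  then consider "rdvd R p a" | "rdvd R p b" using p Cons.prems unfolding rprime_def by blast
  then show ?case
  proof cases
    case 1
    then obtain a' where a': "a' \<in> R" "a = p * a'" by (auto simp: rdvd_def)
    have "p * (a' * b) = p * (u * prod_list ps)" using Cons.prems(5) a' by (simp add: ac_simps)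
    then have "a' * b = u * prod_list ps" using p by (simp add: rprime_def)
    then obtain v w ps1 ps2 where *: "runit R v" "runit R w" "a' = v * prod_list ps1"
      "b = w * prod_list ps2" "set ps1 \<union> set ps2 = set ps" "length ps1 + length ps2 = length ps"
      using Cons.IH[OF a'(1) Cons.prems(2,3)] Cons.prems(4) by auto
    then have "a = v * prod_list (p # ps1)" using a' by (simp add: ac_simps)
    with * show ?thesis
      by (intro exI[of _ v] exI[of _ w] exI[of _ "p # ps1"] exI[of _ ps2]) auto
  next
    case 2
    then obtain b' where b': "b' \<in> R" "b = p * b'" by (auto simp: rdvd_def)
    have "p * (a * b') = p * (u * prod_list ps)" using Cons.prems(5) b' by (simp add: ac_simps)
    then have "a * b' = u * prod_list ps" using p by (simp add: rprime_def)
    then obtain v w ps1 ps2 where *: "runit R v" "runit R w" "a = v * prod_list ps1"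
      "b' = w * prod_list ps2" "set ps1 \<union> set ps2 = set ps" "length ps1 + length ps2 = length ps"
      using Cons.IH[OF Cons.prems(1) b'(1) Cons.prems(3)] Cons.prems(4) by auto
    then have "b = w * prod_list (p # ps2)" using b' by (simp add: ac_simps)
    with * show ?thesis
      by (intro exI[of _ v] exI[of _ w] exI[of _ ps1] exI[of _ "p # ps2"]) auto
  qed
qed

text \<open>Every nonunit on the left has to absorb at least one prime on the right. If the two
  counts agree, each absorbs exactly one and is an associate of it. The left side is allowed to
  consist of mere nonunits because truncated or shifted factors are not known to be
  irreducible.\<close>

lemma prime_list_match:
  assumes "runit R u" "\<forall>p\<in>set ps. rprime R p" "\<forall>q\<in>set qs. q \<in> R \<and> \<not> runit R q"
    and "prod_list qs = u * prod_list ps"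
  shows "length qs \<le> length ps \<and>
    (length qs = length ps \<longrightarrow> (\<forall>p\<in>set ps. \<exists>q\<in>set qs. \<exists>v. runit R v \<and> q = v * p))"
  using assms
proof (induction qs arbitrary: ps u)
  case Nil
  then show ?case by simp
next
  case (Cons q qs)
  have "q \<in> R" "prod_list qs \<in> R" using Cons.prems by (auto intro: prod_list_mem)
  then obtain v w ps1 ps2 where *: "runit R v" "runit R w" "q = v * prod_list ps1"
      "prod_list qs = w * prod_list ps2" "set ps1 \<union> set ps2 = set ps"
      "length ps1 + length ps2 = length ps"
    using prime_list_split[of q "prod_list qs" u ps] Cons.prems by auto
  have "ps1 \<noteq> []" using * Cons.prems by auto
  then have l1: "length ps1 \<ge> 1" by (cases ps1) auto
  have IH: "length qs \<le> length ps2 \<and>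
    (length qs = length ps2 \<longrightarrow> (\<forall>p\<in>set ps2. \<exists>q\<in>set qs. \<exists>v. runit R v \<and> q = v * p))"
    by (rule Cons.IH[OF *(2)]) (use * Cons.prems in auto)
  show ?case
  proof (intro conjI impI ballI)
    show "length (q # qs) \<le> length ps" using IH l1 *(6) by simp
    fix p assume eq: "length (q # qs) = length ps" and p: "p \<in> set ps"
    then have "length ps1 = 1" and eq2: "length qs = length ps2" using IH l1 *(6) by auto
    then obtain p1 where "ps1 = [p1]" by (cases ps1) auto
    then show "\<exists>q\<in>set (q # qs). \<exists>v. runit R v \<and> q = v * p"
      using IH eq2 p *(1,3,5) by auto
  qed
qed

lemma rprime_assoc:
  assumes p: "rprime R p" and u: "runit R u"
  shows "rprime R (u * p)"
proof -
  obtain v where v: "runit R v" "u * v = 1" using runit_inverse[OF u] .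
  have *: "rdvd R (u * p) a \<longleftrightarrow> rdvd R p a" for a
  proof
    assume "rdvd R (u * p) a"
    then obtain c where "c \<in> R" "a = u * p * c" by (auto simp: rdvd_def)
    then show "rdvd R p a" using u unfolding rdvd_def runit_def
      by (intro bexI[of _ "u * c"]) auto
  next
    assume "rdvd R p a"
    then obtain c where c: "c \<in> R" "a = p * c" by (auto simp: rdvd_def)
    have "u * p * (v * c) = (u * v) * (p * c)" by (simp add: ac_simps)
    then show "rdvd R (u * p) a" using v c unfolding rdvd_def runit_def
      by (intro bexI[of _ "v * c"]) auto
  qed
  have "u \<noteq> 0" "u \<in> R" "p \<in> R" using v u p by (auto simp: runit_def rprime_def)
  then show ?thesis
    using p runit_mult_iff[of u p] unfolding rprime_def * by auto
qed

section \<open>Univariate polynomials with coefficients in a subring\<close>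

lemma subdomain_polys_over: "subdomain (polys_over R)"
proof
  fix a b assume "a \<in> polys_over R" "b \<in> polys_over R"
  then show "a - b \<in> polys_over R" "a * b \<in> polys_over R"
    by (auto simp: polys_over_def coeff_mult intro!: sum_mem)
qed (auto simp: polys_over_def coeff_1)

interpretation X: subdomain "polys_over R" by (rule subdomain_polys_over)

lemma const_mem [simp]: "[:c:] \<in> polys_over R \<longleftrightarrow> c \<in> R"
  by (auto simp: polys_over_def coeff_pCons split: nat.splits)

lemma monom_mem: "c \<in> R \<Longrightarrow> monom c n \<in> polys_over R"
  by (auto simp: polys_over_def)

lemma smult_mem: "c \<in> R \<Longrightarrow> p \<in> polys_over R \<Longrightarrow> smult c p \<in> polys_over R"
  by (auto simp: polys_over_def)

lemma coeff_mem: "p \<in> polys_over R \<Longrightarrow> coeff p i \<in> R"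
  by (auto simp: polys_over_def)

lemma runit_const [simp]: "runit (polys_over R) [:c:] \<longleftrightarrow> runit R c"
proof
  assume "runit (polys_over R) [:c:]"
  then obtain q where q: "q \<in> polys_over R" "1 = [:c:] * q" and c: "c \<in> R"
    by (auto simp: runit_def rdvd_def)
  have "1 = c * coeff q 0" using arg_cong[OF q(2), of "\<lambda>p. coeff p 0"] by simp
  then show "runit R c" using c coeff_mem[OF q(1)] by (auto simp: runit_def rdvd_def)
next
  assume "runit R c"
  then obtain d where "c \<in> R" "d \<in> R" "1 = c * d" by (auto simp: runit_def rdvd_def)
  then show "runit (polys_over R) [:c:]"
    by (auto simp: runit_def rdvd_def intro!: bexI[of _ "[:d:]"])
qed

lemma runit_polys_degree:
  assumes "runit (polys_over R) p" shows "degree p = 0"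
proof -
  obtain q where q: "1 = p * q" using assms by (auto simp: runit_def rdvd_def)
  then have "p \<noteq> 0" "q \<noteq> 0" by auto
  then have "degree (1 :: 'a poly) = degree p + degree q" unfolding q by (rule degree_mult_eq)
  then show ?thesis by simp
qed

lemma rdvd_const_iff:
  "rdvd (polys_over R) [:c:] p \<longleftrightarrow> (\<forall>i. rdvd R c (coeff p i))"
proof
  assume "rdvd (polys_over R) [:c:] p"
  then show "\<forall>i. rdvd R c (coeff p i)" by (auto simp: rdvd_def polys_over_def)
next
  assume "\<forall>i. rdvd R c (coeff p i)"
  then obtain f where f: "\<And>i. f i \<in> R" "\<And>i. coeff p i = c * f i"
    unfolding rdvd_def by metis
  \<comment> \<open>The witnesses \<open>f i\<close> exist for all i; the cut at the degree of
    \<open>p\<close> makes the quotient a polynomial.\<close>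
  define q where "q = (\<Sum>i\<le>degree p. monom (f i) i)"
  have "p = (\<Sum>i\<le>degree p. monom (coeff p i) i)" by (simp add: poly_as_sum_of_monoms)
  also have "\<dots> = [:c:] * q" by (simp add: f(2) q_def sum_distrib_left smult_monom)
  finally show "rdvd (polys_over R) [:c:] p"
    unfolding rdvd_def q_def using f(1) by (intro bexI[of _ q]) (auto simp: q_def intro!: X.sum_mem monom_mem)
qed

lemma rdvd_add: "rdvd R p a \<Longrightarrow> rdvd R p b \<Longrightarrow> rdvd R p (a + b)"
  unfolding rdvd_def by (metis add_mem distrib_left)

lemma rdvd_diff: "rdvd R p a \<Longrightarrow> rdvd R p b \<Longrightarrow> rdvd R p (a - b)"
  unfolding rdvd_def by (metis diff_mem right_diff_distrib)

lemma rdvd_sum: "(\<And>i. i \<in> I \<Longrightarrow> rdvd R p (f i)) \<Longrightarrow> rdvd R p (sum f I)"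
  by (induction I rule: infinite_finite_induct) (auto intro: rdvd_add simp: rdvd_def[of _ _ 0])

lemma rdvd_mult: "rdvd R p a \<Longrightarrow> b \<in> R \<Longrightarrow> rdvd R p (a * b)"
  unfolding rdvd_def by (metis mult.assoc mult_mem)

text \<open>Gauss's argument: let i and j be the lowest positions at which \<open>a\<close> and
  \<open>b\<close> have coefficients not divisible by p. In the coefficient of the product at i + j,
  every term other than the one from i and j has an index below i or below j and is divisible by
  p.\<close>

lemma rprime_const:
  assumes p: "rprime R p" shows "rprime (polys_over R) [:p:]"
  unfolding rprime_def
proof (intro conjI ballI impI)
  show "[:p:] \<in> polys_over R" "[:p:] \<noteq> 0" "\<not> runit (polys_over R) [:p:]"
    using p by (auto simp: rprime_def)
  fix a b assume a: "a \<in> polys_over R" and b: "b \<in> polys_over R"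
    and d: "rdvd (polys_over R) [:p:] (a * b)"
  show "rdvd (polys_over R) [:p:] a \<or> rdvd (polys_over R) [:p:] b"
  proof (rule ccontr)
    assume "\<not> ?thesis"
    then have ex: "\<exists>i. \<not> rdvd R p (coeff a i)" "\<exists>i. \<not> rdvd R p (coeff b i)"
      unfolding rdvd_const_iff by auto
    define i where "i = (LEAST i. \<not> rdvd R p (coeff a i))"
    define j where "j = (LEAST i. \<not> rdvd R p (coeff b i))"
    have i: "\<not> rdvd R p (coeff a i)" and j: "\<not> rdvd R p (coeff b j)"
      unfolding i_def j_def using LeastI_ex[OF ex(1)] LeastI_ex[OF ex(2)] by auto
    have i': "rdvd R p (coeff a k)" if "k < i" for k using that not_less_Least i_def by blast
    have j': "rdvd R p (coeff b k)" if "k < j" for k using that not_less_Least j_def by blast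
    have "coeff (a * b) (i + j) = (\<Sum>k\<le>i+j. coeff a k * coeff b (i + j - k))"
      by (rule coeff_mult)
    also have "\<dots> = coeff a i * coeff b j + (\<Sum>k\<in>{..i+j}-{i}. coeff a k * coeff b (i + j - k))"
      by (subst sum.remove[of _ i]) auto
    finally have eq: "coeff a i * coeff b j = coeff (a * b) (i + j)
        - (\<Sum>k\<in>{..i+j}-{i}. coeff a k * coeff b (i + j - k))" by simp
    have "rdvd R p (coeff a i * coeff b j)"
      unfolding eq
    proof (rule rdvd_diff[OF _ rdvd_sum])
      show "rdvd R p (coeff (a * b) (i + j))" using d rdvd_const_iff by blast
      fix k assume "k \<in> {..i+j}-{i}"
      then consider "k < i" | "i + j - k < j" by fastforce
      then show "rdvd R p (coeff a k * coeff b (i + j - k))"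
      proof cases
        case 1 then show ?thesis using i' b coeff_mem rdvd_mult by blast
      next
        case 2 then show ?thesis using j' a coeff_mem rdvd_mult by (metis mult.commute)
      qed
    qed
    then show False using p i j coeff_mem[OF a] coeff_mem[OF b] unfolding rprime_def by blast
  qed
qed

text \<open>Division with remainder without a field of fractions: each reduction step multiplies by
  the leading coefficient of \<open>d\<close>, so that the top terms cancel, and \<open>c\<close>
  collects these multipliers.\<close>

lemma pseudo_division:
  assumes d: "d \<in> polys_over R" "d \<noteq> 0" and g: "g \<in> polys_over R"
  shows "\<exists>c q r. c \<in> R \<and> c \<noteq> 0 \<and> q \<in> polys_over R \<and> r \<in> polys_over R \<and>
    smult c g = q * d + r \<and> (r = 0 \<or> degree r < degree d)"
  using g
proof (induction "degree g" arbitrary: g rule: less_induct)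
  case less
  let ?S = "polys_over R"
  show ?case
  proof (cases "g = 0 \<or> degree g < degree d")
    case True
    then show ?thesis using less.prems by (intro exI[of _ 1] exI[of _ 0] exI[of _ g]) auto
  next
    case False
    then have g0: "g \<noteq> 0" and deg: "degree d \<le> degree g" by auto
    define l where "l = lead_coeff d"
    define t where "t = monom (lead_coeff g) (degree g - degree d)"
    have l: "l \<in> R" "l \<noteq> 0" using d coeff_mem by (auto simp: l_def)
    have t: "t \<in> ?S" using less.prems by (auto simp: t_def intro!: monom_mem coeff_mem)
    define h where "h = smult l g - t * d"
    have h: "h \<in> ?S" using l t d less.prems by (auto simp: h_def intro!: smult_mem)
    have dt: "degree t = degree g - degree d" using g0 by (simp add: t_def degree_monom_eq)
    have "t \<noteq> 0" using g0 by (simp add: t_def)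
    then have dtd: "degree (t * d) = degree g" using d deg dt by (simp add: degree_mult_eq)
    have "coeff (t * d) (degree g) = lead_coeff g * l"
      by (metis dtd l_def lead_coeff_mult t_def lead_coeff_monom)
    then have top: "coeff h (degree g) = 0" by (simp add: h_def)
    have dh: "degree h \<le> degree g" using dtd l by (auto simp: h_def intro!: degree_diff_le)
    show ?thesis
    proof (cases "h = 0")
      case True
      then show ?thesis using l t by (intro exI[of _ l] exI[of _ t] exI[of _ 0]) (auto simp: h_def)
    next
      case False
      then have "degree h < degree g" using top dh
        by (metis le_neq_implies_less leading_coeff_0_iff)
      from less.hyps[OF this h] obtain c q r where *: "c \<in> R" "c \<noteq> 0" "q \<in> ?S" "r \<in> ?S"
        "smult c h = q * d + r" "r = 0 \<or> degree r < degree d" by auto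
      have "smult (c * l) g = (q + smult c t) * d + r"
        using *(5) by (simp add: h_def smult_diff_right algebra_simps)
      then show ?thesis using * l t
        by (intro exI[of _ "c * l"] exI[of _ "q + smult c t"] exI[of _ r]) (auto intro!: smult_mem)
    qed
  qed
qed

end

section \<open>Polynomials over a factorial ring form a factorial ring\<close>

locale factorial_subdomain = subdomain +
  assumes factorial: "factorial_set R"
begin

interpretation X: subdomain "polys_over R" by (rule subdomain_polys_over)

text \<open>A fraction-free Gauss lemma: each prime factor of \<open>c\<close> remains prime among
  the polynomials by \<open>rprime_const\<close>, hence divides \<open>q\<close> or \<open>d\<close>
  and can be cancelled there. The unit part of \<open>c\<close> goes into \<open>q\<close>.\<close>

lemma smult_factor_split:
  assumes c: "c \<in> R" "c \<noteq> 0" and mem: "p \<in> polys_over R" "q \<in> polys_over R" "d \<in> polys_over R"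
    and eq: "smult c p = q * d"
  shows "\<exists>c1 c2 q' d'. c1 \<in> R \<and> c2 \<in> R \<and> q' \<in> polys_over R \<and> d' \<in> polys_over R \<and>
    q = smult c1 q' \<and> d = smult c2 d' \<and> p = q' * d'"
proof -
  obtain u ps where u: "runit R u" and ps: "\<forall>p\<in>set ps. rprime R p" and cu: "c = u * prod_list ps"
    using factorial c unfolding factorial_set_def by blast
  have "smult (u * prod_list ps) p = q * d" using eq cu by simp
  then show ?thesis using mem ps
  proof (induction ps arbitrary: q d)
    case Nil
    obtain v where v: "runit R v" "u * v = 1" using runit_inverse[OF u] .
    have "smult v (q * d) = smult (u * v) p" using Nil.prems(1)[symmetric] by (simp add: ac_simps)
    then have "p = smult v q * d" using v by simp
    moreover have "q = smult u (smult v q)" using v by simp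
    moreover have "u \<in> R" "v \<in> R" using u v by (auto simp: runit_def)
    ultimately show ?case using Nil.prems
      by (intro exI[of _ u] exI[of _ 1] exI[of _ "smult v q"] exI[of _ d]) (auto intro: smult_mem)
  next
    case (Cons \<pi> ps)
    have pi: "rprime R \<pi>" "\<pi> \<in> R" "\<pi> \<noteq> 0" using Cons.prems by (auto simp: rprime_def)
    have psR: "set ps \<subseteq> R" using Cons.prems by (auto simp: rprime_def)
    have "rdvd (polys_over R) [:\<pi>:] (q * d)"
      using Cons.prems u psR
      unfolding rdvd_def Cons.prems(1)[symmetric]
      by (intro bexI[of _ "smult (u * prod_list ps) p"])
        (auto simp: ac_simps runit_def intro!: smult_mem mult_mem prod_list_mem)
    then consider "rdvd (polys_over R) [:\<pi>:] q" | "rdvd (polys_over R) [:\<pi>:] d"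
      using rprime_const[OF pi(1)] Cons.prems(3,4) unfolding rprime_def[of "polys_over R"] by blast
    then show ?case
    proof cases
      case 1
      then obtain q0 where q0: "q0 \<in> polys_over R" "q = smult \<pi> q0" by (auto simp: rdvd_def)
      have "smult \<pi> (smult (u * prod_list ps) p) = smult \<pi> (q0 * d)"
        using Cons.prems(1) q0 by (simp add: ac_simps)
      then have "smult (u * prod_list ps) p = q0 * d" using pi(3) smult_left_cancel by blast
      from Cons.IH[OF this Cons.prems(2) q0(1) Cons.prems(4)] Cons.prems(5)
      obtain c1 c2 q' d' where *: "c1 \<in> R" "c2 \<in> R" "q' \<in> polys_over R" "d' \<in> polys_over R"
        "q0 = smult c1 q'" "d = smult c2 d'" "p = q' * d'" by auto
      then show ?thesis using pi q0
        by (intro exI[of _ "\<pi> * c1"] exI[of _ c2] exI[of _ q'] exI[of _ d']) auto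
    next
      case 2
      then obtain d0 where d0: "d0 \<in> polys_over R" "d = smult \<pi> d0" by (auto simp: rdvd_def)
      have "smult \<pi> (smult (u * prod_list ps) p) = smult \<pi> (q * d0)"
        using Cons.prems(1) d0 by (simp add: ac_simps)
      then have "smult (u * prod_list ps) p = q * d0" using pi(3) smult_left_cancel by blast
      from Cons.IH[OF this Cons.prems(2,3) d0(1)] Cons.prems(5)
      obtain c1 c2 q' d' where *: "c1 \<in> R" "c2 \<in> R" "q' \<in> polys_over R" "d' \<in> polys_over R"
        "q = smult c1 q'" "d0 = smult c2 d'" "p = q' * d'" by auto
      then show ?thesis using pi d0
        by (intro exI[of _ c1] exI[of _ "\<pi> * c2"] exI[of _ q'] exI[of _ d']) auto
    qed
  qed
qed

text \<open>Splitting \<open>c\<close> over the right-hand side writes p as a constant times p'. As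
  p' has positive degree it is no unit, so irreducibility makes the constant a unit, and p' divides
  \<open>b\<close>.\<close>

lemma rdvd_cancel_const:
  assumes p: "rirreducible (polys_over R) p" "degree p > 0"
    and c: "c \<in> R" "c \<noteq> 0" and mem: "b \<in> polys_over R" "z \<in> polys_over R"
    and eq: "smult c b = z * p"
  shows "rdvd (polys_over R) p b"
proof -
  have pS: "p \<in> polys_over R" "p \<noteq> 0" using p by (auto simp: rirreducible_def)
  from smult_factor_split[OF c mem(1,2) pS(1) eq] obtain c2 z' p' where
    *: "c2 \<in> R" "z' \<in> polys_over R" "p' \<in> polys_over R" "p = smult c2 p'" "b = z' * p'" by auto
  have "p = [:c2:] * p'" using * by simp
  moreover have "\<not> runit (polys_over R) p'"
    using runit_polys_degree[of p'] p(2) *(4) by (cases "c2 = 0") auto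
  ultimately have "runit R c2"
    using p(1) * unfolding rirreducible_def by (metis const_mem runit_const)
  then obtain v where v: "runit R v" "c2 * v = 1" by (rule runit_inverse)
  have "b = p * smult v z'" using * v by (simp add: ac_simps)
  then show ?thesis using v * unfolding rdvd_def
    by (intro bexI[of _ "smult v z'"]) (auto simp: runit_def intro: smult_mem)
qed

text \<open>Irreducibility forces all but the first prime factor of \<open>c\<close> to be absorbed
  into a unit, so \<open>c\<close> is an associate of a prime of \<open>R\<close>.\<close>

lemma rprime_of_rirreducible_const:
  assumes p: "rirreducible (polys_over R) [:c:]"
  shows "rprime (polys_over R) [:c:]"
proof -
  have c: "c \<in> R" "c \<noteq> 0" "\<not> runit R c" using p by (auto simp: rirreducible_def)
  obtain u ps where u: "runit R u" and ps: "\<forall>p\<in>set ps. rprime R p" and cu: "c = u * prod_list ps"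
    using factorial c unfolding factorial_set_def by blast
  then obtain q qs where qs: "ps = q # qs" using c by (cases ps) auto
  have q: "rprime R q" using qs ps by simp
  have mem: "u * prod_list qs \<in> R"
    using u qs ps by (auto simp: runit_def rprime_def intro!: mult_mem prod_list_mem)
  have "[:c:] = [:q:] * [:u * prod_list qs:]" using cu qs by (simp add: ac_simps)
  moreover have "[:q:] \<in> polys_over R" "[:u * prod_list qs:] \<in> polys_over R"
    using q mem by (auto simp: rprime_def)
  ultimately have "runit (polys_over R) [:q:] \<or> runit (polys_over R) [:u * prod_list qs:]"
    using p unfolding rirreducible_def by blast
  then have "runit R (u * prod_list qs)" using q by (auto simp: rprime_def)
  from rprime_assoc[OF q this] have "rprime R c" using cu qs by (simp add: ac_simps)
  then show ?thesis by (rule rprime_const)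
qed

text \<open>If p divides a b, take d of least degree among the combinations of p and a.  By pseudo-division
  constant multiples of p and of a are divisible by d, so up to constants d is either p, and then
  p divides a, or 1, and then p divides a constant multiple of b.  The constants are removed with
  \<open>rdvd_cancel_const\<close>.\<close>

lemma rprime_of_rirreducible_nonconst:
  assumes p: "rirreducible (polys_over R) p" and deg: "degree p > 0"
  shows "rprime (polys_over R) p"
  unfolding rprime_def
proof (intro conjI ballI impI)
  let ?S = "polys_over R"
  show pS: "p \<in> ?S" and p0: "p \<noteq> 0" and "\<not> runit ?S p" using p by (auto simp: rirreducible_def)
  fix a b assume a: "a \<in> ?S" and b: "b \<in> ?S" and "rdvd ?S p (a * b)"
  then obtain w where w: "w \<in> ?S" "a * b = p * w" by (auto simp: rdvd_def)
  define I where "I = {u * p + v * a | u v. u \<in> ?S \<and> v \<in> ?S}"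
  have I_sub: "I \<subseteq> ?S" using pS a by (auto simp: I_def)
  have Ip: "p \<in> I" unfolding I_def mem_Collect_eq by (rule exI[of _ 1], rule exI[of _ 0]) auto
  have Ia: "a \<in> I" unfolding I_def mem_Collect_eq by (rule exI[of _ 0], rule exI[of _ 1]) auto
  have I_diff: "smult c x - q * y \<in> I" if xy: "x \<in> I" "y \<in> I" and cq: "c \<in> R" "q \<in> ?S" for x y c q
  proof -
    obtain u v u' v' where "u \<in> ?S" "v \<in> ?S" "u' \<in> ?S" "v' \<in> ?S"
      "x = u * p + v * a" "y = u' * p + v' * a" using xy by (auto simp: I_def)
    then show ?thesis using cq unfolding I_def mem_Collect_eq
      by (intro exI[of _ "smult c u - q * u'"] exI[of _ "smult c v - q * v'"])
        (auto simp: algebra_simps smult_add_right intro!: smult_mem)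
  qed
  obtain d where d: "d \<in> I" "d \<noteq> 0" and least: "\<And>e. e \<in> I \<Longrightarrow> e \<noteq> 0 \<Longrightarrow> degree d \<le> degree e"
    using ex_has_least_nat[of "\<lambda>d. d \<in> I \<and> d \<noteq> 0" p degree] Ip p0 by blast
  have dS: "d \<in> ?S" using d I_sub by auto
  have mult: "\<exists>c q. c \<in> R \<and> c \<noteq> 0 \<and> q \<in> ?S \<and> smult c x = q * d" if "x \<in> I" for x
  proof -
    obtain c q r where *: "c \<in> R" "c \<noteq> 0" "q \<in> ?S" "smult c x = q * d + r"
      "r = 0 \<or> degree r < degree d"
      using pseudo_division[OF dS d(2), of x] \<open>x \<in> I\<close> I_sub by blast
    have "r = smult c x - q * d" using *(4) by simp
    then have "r \<in> I" using I_diff[OF \<open>x \<in> I\<close> d(1) *(1,3)] by simp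
    then have "r = 0" using least *(5) by force
    then show ?thesis using * by auto
  qed
  obtain c q where cq: "c \<in> R" "c \<noteq> 0" "q \<in> ?S" "smult c p = q * d" using mult[OF Ip] by auto
  \<comment> \<open>So far \<open>d\<close> divides only a constant multiple of p. Splitting off the
    constant gives a factorization of p itself, to which irreducibility applies.\<close>
  from smult_factor_split[OF cq(1,2) pS cq(3) dS cq(4)] obtain c2 q' d' where
    *: "c2 \<in> R" "q' \<in> ?S" "d' \<in> ?S" "d = smult c2 d'" "p = q' * d'" by auto
  then consider "runit ?S q'" | "runit ?S d'" using p unfolding rirreducible_def by blast
  then show "rdvd ?S p a \<or> rdvd ?S p b"
  proof cases
    case 1
    obtain e s where e: "e \<in> R" "e \<noteq> 0" "s \<in> ?S" "smult e a = s * d" using mult[OF Ia] by auto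
    obtain t where t: "runit ?S t" "q' * t = 1" using 1 by (rule X.runit_inverse)
    have "p * t = (q' * t) * d'" using *(5) by (simp add: ac_simps)
    then have "p * t = d'" using t by simp
    then have "smult e a = smult c2 (s * t) * p" using e(4) *(4) by (auto simp: ac_simps)
    moreover have "smult c2 (s * t) \<in> ?S" using e t * by (auto simp: runit_def intro!: smult_mem)
    ultimately have "rdvd ?S p a" using rdvd_cancel_const[OF p deg e(1,2) a] by blast
    then show ?thesis ..
  next
    case 2
    then have "degree d = 0" using runit_polys_degree[OF 2] *(4) by simp
    then obtain k where k: "d = [:k:]" by (rule degree_eq_zeroE)
    then have kR: "k \<in> R" "k \<noteq> 0" using dS d(2) by auto
    obtain u v where uv: "u \<in> ?S" "v \<in> ?S" "d = u * p + v * a" using d(1) by (auto simp: I_def)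
    have "smult k b = d * b" using k by simp
    also have "\<dots> = u * p * b + v * (a * b)" using uv by (simp add: algebra_simps)
    also have "\<dots> = (u * b + v * w) * p" using w by (simp add: algebra_simps)
    finally have "rdvd ?S p b"
      using rdvd_cancel_const[OF p deg kR b, of "u * b + v * w"] uv b w by auto
    then show ?thesis ..
  qed
qed

lemma rprime_of_rirreducible:
  assumes "rirreducible (polys_over R) p" shows "rprime (polys_over R) p"
proof (cases "degree p = 0")
  case True
  then obtain c where "p = [:c:]" by (rule degree_eq_zeroE)
  then show ?thesis using assms rprime_of_rirreducible_const by simp
qed (use assms rprime_of_rirreducible_nonconst in auto)

text \<open>The measure of the induction is the degree plus the number of primes in the leading coefficient.\<close>

lemma factorial_polys_over: "factorial_set (polys_over R)"
proof -
  let ?S = "polys_over R"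
  have main: "\<exists>v qs. runit ?S v \<and> (\<forall>q\<in>set qs. rprime ?S q) \<and> p = v * prod_list qs"
    if "p \<in> ?S" "p \<noteq> 0" "runit R u" "\<forall>q\<in>set ps. rprime R q" "lead_coeff p = u * prod_list ps"
    for p u ps
    using that
  proof (induction "degree p + length ps" arbitrary: p u ps rule: less_induct)
    case less
    consider "runit ?S p" | "rirreducible ?S p" |
      a b where "a \<in> ?S" "b \<in> ?S" "p = a * b" "\<not> runit ?S a" "\<not> runit ?S b"
      using less.prems unfolding rirreducible_def by blast
    then show ?case
    proof cases
      case 1
      then show ?thesis by (intro exI[of _ p] exI[of _ "[]"]) simp
    next
      case 2
      then show ?thesis using rprime_of_rirreducible by (intro exI[of _ 1] exI[of _ "[p]"]) simp
    next
      case (3 a b)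
      have ab0: "a \<noteq> 0" "b \<noteq> 0" using 3 less.prems by auto
      have dp: "degree p = degree a + degree b" using 3 ab0 by (simp add: degree_mult_eq)
      have "lead_coeff a * lead_coeff b = u * prod_list ps"
        using less.prems(5) 3 by (simp add: lead_coeff_mult)
      then obtain v w ps1 ps2 where *: "runit R v" "runit R w" "lead_coeff a = v * prod_list ps1"
        "lead_coeff b = w * prod_list ps2" "set ps1 \<union> set ps2 = set ps"
        "length ps1 + length ps2 = length ps"
        using prime_list_split[of "lead_coeff a" "lead_coeff b" u ps] 3 coeff_mem less.prems by blast
      \<comment> \<open>A nonunit has positive measure, since measure 0 would make it a constant
        unit. As the measure is additive on products, both factors have smaller measure than
        \<open>p\<close>.\<close>
      have pos: "degree x + length xs > 0"
        if "x \<in> ?S" "\<not> runit ?S x" "lead_coeff x = v * prod_list xs" "runit R v" for x xs v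
      proof (rule ccontr)
        assume "\<not> ?thesis"
        then have "degree x = 0" "xs = []" by auto
        then obtain k where k: "x = [:k:]" using degree_eq_zeroE by blast
        then show False using that \<open>xs = []\<close> by simp
      qed
      have l1: "degree a + length ps1 < degree p + length ps"
        using pos[OF 3(2,5) *(4,2)] dp *(6) by linarith
      have l2: "degree b + length ps2 < degree p + length ps"
        using pos[OF 3(1,4) *(3,1)] dp *(6) by linarith
      have primes: "\<forall>q\<in>set ps1. rprime R q" "\<forall>q\<in>set ps2. rprime R q"
        using *(5) less.prems(4) by auto
      obtain va qa where A: "runit ?S va" "\<forall>q\<in>set qa. rprime ?S q" "a = va * prod_list qa"
        using less.hyps[OF l1 3(1) ab0(1) *(1) primes(1) *(3)] by auto
      obtain vb qb where B: "runit ?S vb" "\<forall>q\<in>set qb. rprime ?S q" "b = vb * prod_list qb"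
        using less.hyps[OF l2 3(2) ab0(2) *(2) primes(2) *(4)] by auto
      have "runit ?S (va * vb)" using A B X.runit_mult_iff by (auto simp: runit_def)
      moreover have "p = va * vb * prod_list (qa @ qb)" using 3 A B by (simp add: ac_simps)
      ultimately show ?thesis using A B
        by (intro exI[of _ "va * vb"] exI[of _ "qa @ qb"]) auto
    qed
  qed
  show ?thesis
    unfolding factorial_set_def
  proof (intro ballI impI)
    fix p assume p: "p \<in> ?S" "p \<noteq> 0"
    then have "lead_coeff p \<in> R" "lead_coeff p \<noteq> 0" using coeff_mem by auto
    then obtain u ps where "runit R u" "\<forall>q\<in>set ps. rprime R q" "lead_coeff p = u * prod_list ps"
      using factorial unfolding factorial_set_def by blast
    then show "\<exists>v qs. runit ?S v \<and> (\<forall>q\<in>set qs. rprime ?S q) \<and> p = v * prod_list qs"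
      by (rule main[OF p])
  qed
qed

end

section \<open>Polynomials in finitely many variables\<close>

abbreviation "lookup \<equiv> Poly_Mapping.lookup"
abbreviation "keys \<equiv> Poly_Mapping.keys"
abbreviation "single \<equiv> Poly_Mapping.single"

text \<open>Divisibility, units and primes are defined through multiplication, 0 and 1 alone, so an
  injective map respecting these carries prime factorizations over.\<close>

lemma factorial_set_transport:
  fixes \<phi> :: "'b::idom \<Rightarrow> 'a::idom"
  assumes S: "subdomain S" and inj: "inj_on \<phi> S"
    and mult: "\<And>a b. a \<in> S \<Longrightarrow> b \<in> S \<Longrightarrow> \<phi> (a * b) = \<phi> a * \<phi> b"
    and one: "\<phi> 1 = 1" and zero: "\<phi> 0 = 0" and fact: "factorial_set S"
  shows "factorial_set (\<phi> ` S)"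
proof -
  interpret subdomain S by (rule S)
  have dvd: "rdvd (\<phi> ` S) (\<phi> a) (\<phi> b) \<longleftrightarrow> rdvd S a b" if "a \<in> S" "b \<in> S" for a b
  proof -
    have "\<phi> b = \<phi> a * \<phi> c \<longleftrightarrow> b = a * c" if "c \<in> S" for c
      using inj_on_eq_iff[OF inj, of b "a * c"] \<open>a \<in> S\<close> \<open>b \<in> S\<close> that by (simp add: mult mult_mem)
    then show ?thesis by (auto simp: rdvd_def)
  qed
  have unit: "runit (\<phi> ` S) (\<phi> a) \<longleftrightarrow> runit S a" if "a \<in> S" for a
    using dvd[of a 1] that by (auto simp: runit_def one)
  have nz: "\<phi> a = 0 \<longleftrightarrow> a = 0" if "a \<in> S" for a
    using inj that zero zero_mem unfolding inj_on_def by metis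
  have prime: "rprime (\<phi> ` S) (\<phi> p)" if "rprime S p" for p
  proof -
    have pS: "p \<in> S" using that by (auto simp: rprime_def)
    have "rdvd (\<phi> ` S) (\<phi> p) (\<phi> a) \<or> rdvd (\<phi> ` S) (\<phi> p) (\<phi> b)"
      if "a \<in> S" "b \<in> S" "rdvd (\<phi> ` S) (\<phi> p) (\<phi> a * \<phi> b)" for a b
      using \<open>rprime S p\<close> that dvd[OF pS] unfolding rprime_def by (metis mult mult_mem)
    then show ?thesis using \<open>rprime S p\<close> pS unit nz unfolding rprime_def by auto
  qed
  have prod: "\<phi> (prod_list ps) = prod_list (map \<phi> ps)" if "set ps \<subseteq> S" for ps
    using that by (induction ps) (auto simp: one mult prod_list_mem)
  show ?thesis
    unfolding factorial_set_def
  proof (intro ballI impI)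
    fix b assume "b \<in> \<phi> ` S" "b \<noteq> 0"
    then obtain a where a: "a \<in> S" "b = \<phi> a" "a \<noteq> 0" using zero by auto
    then obtain u ps where *: "runit S u" "\<forall>p\<in>set ps. rprime S p" "a = u * prod_list ps"
      using fact unfolding factorial_set_def by blast
    have u: "u \<in> S" and ps: "set ps \<subseteq> S" using * by (auto simp: runit_def rprime_def)
    have "b = \<phi> u * prod_list (map \<phi> ps)"
      using a * u ps by (simp add: mult prod_list_mem prod)
    moreover have "runit (\<phi> ` S) (\<phi> u)" using unit u * by simp
    ultimately show "\<exists>u ps. runit (\<phi> ` S) u \<and> (\<forall>p\<in>set ps. rprime (\<phi> ` S) p) \<and> b = u * prod_list ps"
      using * prime by (intro exI[of _ "\<phi> u"] exI[of _ "map \<phi> ps"]) auto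
  qed
qed

lemma factorial_int: "factorial_set (UNIV :: int set)"
  unfolding factorial_set_def
proof (intro ballI impI)
  fix a :: int assume "a \<noteq> 0"
  have dvd: "rdvd UNIV x y \<longleftrightarrow> x dvd y" for x y :: int by (auto simp: rdvd_def dvd_def)
  obtain ps where ps: "mset ps = prime_factorization a" by (metis ex_mset)
  have "\<forall>p\<in>set ps. rprime UNIV p"
  proof
    fix p assume "p \<in> set ps"
    then have "p \<in># prime_factorization a" by (metis ps set_mset_mset)
    then have "prime_elem p" by (auto simp: in_prime_factors_iff)
    then show "rprime UNIV p"
      unfolding rprime_def runit_def dvd prime_elem_def by blast
  qed
  moreover have "a = sgn a * prod_list ps"
  proof -
    have "prod_mset (prime_factorization a) = \<bar>a\<bar>"
      using \<open>a \<noteq> 0\<close> by (simp add: prod_mset_prime_factorization)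
    then have "prod_list ps = \<bar>a\<bar>" by (metis ps prod_mset_prod_list)
    then show ?thesis by (simp add: sgn_mult_abs)
  qed
  moreover have "runit UNIV (sgn a)"
    using \<open>a \<noteq> 0\<close> by (auto simp: runit_def dvd sgn_if)
  ultimately show "\<exists>u ps. runit UNIV u \<and> (\<forall>p\<in>set ps. rprime UNIV p) \<and> a = u * prod_list ps"
    by blast
qed

text \<open>The first summand determines the second, and its exponents are bounded by those of m.
  Without finiteness the sum defining \<open>kmul\<close> would collapse to the default value
  0.\<close>

lemma finite_splittings: "finite {(a, b). a + b = (m :: monom)}"
proof -
  let ?F = "{f. \<forall>i. (i \<in> keys m \<longrightarrow> f i \<in> {..Max (lookup m ` keys m)}) \<and> (i \<notin> keys m \<longrightarrow> f i = 0)}"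
  have "finite ?F" by (rule finite_set_of_finite_funs) auto
  moreover have "lookup ` fst ` {(a, b). a + b = m} \<subseteq> ?F"
  proof safe
    fix a b :: monom and i assume "i \<in> keys (a + b)"
    then have "lookup (a + b) i \<le> Max (lookup (a + b) ` keys (a + b))" by simp
    then show "lookup (fst (a, b)) i \<le> Max (lookup (a + b) ` keys (a + b))"
      by (simp add: lookup_add)
  next
    fix a b :: monom and i assume "i \<notin> keys (a + b)"
    then show "lookup (fst (a, b)) i = 0" by (simp add: in_keys_iff lookup_add)
  qed
  ultimately have "finite (lookup ` fst ` {(a, b). a + b = m})" by (rule finite_subset[rotated])
  moreover have "inj_on (lookup \<circ> fst) {(a, b). a + b = m}"
    by (auto simp: inj_on_def lookup_inject)
  ultimately show ?thesis by (metis finite_imageD image_comp)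
qed

text \<open>This identifies the Cauchy product on finitely supported series with the product of
  polynomial mappings, which form an integral domain.\<close>

lemma kmul_lookup: "kmul (lookup f) (lookup g) = lookup (f * g)"
proof
  fix m :: monom
  let ?D = "{(a, b). a + b = m}"
  \<comment> \<open>Subtraction of exponents is truncated; for the l that split off from m it yields
    the true cofactor, and all other l contribute nothing.\<close>
  have inner: "(\<Sum>q. lookup g q when m = l + q) = (if l \<in> fst ` ?D then lookup g (m - l) else 0)" for l
  proof (cases "l \<in> fst ` ?D")
    case True
    then obtain b where "m = l + b" by auto
    then show ?thesis using True by (simp add: when_def)
  next
    case False
    then have "m \<noteq> l + q" for q by force
    then show ?thesis using False by simp
  qed
  have inj: "inj_on fst ?D" by (auto simp: inj_on_def)
  have "lookup (f * g) m = (\<Sum>l. lookup f l * (if l \<in> fst ` ?D then lookup g (m - l) else 0))"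
    by (simp add: lookup_mult inner)
  also have "\<dots> = (\<Sum>l\<in>fst ` ?D. lookup f l * (if l \<in> fst ` ?D then lookup g (m - l) else 0))"
    using finite_splittings by (intro Sum_any.expand_superset) auto
  also have "\<dots> = (\<Sum>p\<in>?D. lookup f (fst p) * lookup g (m - fst p))"
    by (subst sum.reindex[OF inj]) (auto intro!: sum.cong)
  also have "\<dots> = kmul (lookup f) (lookup g) m"
    unfolding kmul_def by (intro sum.cong) auto
  finally show "kmul (lookup f) (lookup g) m = lookup (f * g) m" by simp
qed

definition polys_below :: "nat \<Rightarrow> (monom \<Rightarrow>\<^sub>0 int) set" where
  "polys_below n = {p. \<forall>m\<in>keys p. keys m \<subseteq> {..<n}}"

lemma polys_belowD: "p \<in> polys_below n \<Longrightarrow> lookup p m \<noteq> 0 \<Longrightarrow> keys m \<subseteq> {..<n}"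
  by (auto simp: polys_below_def in_keys_iff)

lemma subdomain_polys_below: "subdomain (polys_below n)"
proof
  show "1 \<in> polys_below n" by (simp add: polys_below_def)
  fix a b assume ab: "a \<in> polys_below n" "b \<in> polys_below n"
  have "keys (a - b) \<subseteq> keys a \<union> keys b" by (auto simp: in_keys_iff lookup_minus)
  then show "a - b \<in> polys_below n" using ab by (auto simp: polys_below_def)
  show "a * b \<in> polys_below n"
    unfolding polys_below_def
  proof (intro CollectI ballI)
    fix m assume "m \<in> keys (a * b)"
    then obtain u v where uv: "u \<in> keys a" "v \<in> keys b" "m = u + v" using keys_mult by blast
    then have "keys m \<subseteq> keys u \<union> keys v" using Poly_Mapping.keys_add by metis
    then show "keys m \<subseteq> {..<n}" using uv ab unfolding polys_below_def by blast
  qed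
qed

text \<open>As \<open>c\<close> is free of the variable with index n, the exponent of that variable
  in a product monomial reveals i, and only one splitting contributes.\<close>

lemma lookup_mult_var_power:
  assumes c: "c \<in> polys_below n" and m: "keys m \<subseteq> {..<n}"
  shows "lookup (c * single (single n i) 1) (m + single n k) = (if i = k then lookup c m else 0)"
proof -
  let ?D = "{(a, b). a + b = m + single n k}"
  have "lookup (c * single (single n i) 1) (m + single n k) =
    (\<Sum>p\<in>?D. lookup c (fst p) * lookup (single (single n i) 1) (snd p))"
    by (simp flip: kmul_lookup add: kmul_def)
  also have "\<dots> = (\<Sum>p\<in>?D. if p = (m, single n i) then lookup c m else 0)"
  proof (rule sum.cong[OF refl])
    fix p assume "p \<in> ?D"
    then obtain a b where ab: "p = (a, b)" "a + b = m + single n k" by auto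
    have "a = m" if "b = single n i" "lookup c a \<noteq> 0"
    proof -
      have "n \<notin> keys a" "n \<notin> keys m" using polys_belowD[OF c that(2)] m by auto
      then have "lookup a n = 0" "lookup m n = 0" by (auto simp: in_keys_iff)
      then have "i = k" using arg_cong[OF ab(2), of "\<lambda>x. lookup x n"] that by (simp add: lookup_add)
      then show ?thesis using ab that by simp
    qed
    then show "lookup c (fst p) * lookup (single (single n i) 1) (snd p) =
      (if p = (m, single n i) then lookup c m else 0)"
      using ab by (auto simp: lookup_single when_def)
  qed
  also have "\<dots> = (if (m, single n i) \<in> ?D then lookup c m else 0)"
    using finite_splittings by (simp add: sum.delta)
  also have "(m, single n i) \<in> ?D \<longleftrightarrow> i = k" using Poly_Mapping.inj_single
    by (auto dest: arg_cong[of _ _ "\<lambda>x. lookup x n"])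
  finally show ?thesis .
qed

lemma single_var_power: "single (single n 1) (1::int) ^ k = single (single n k) 1"
  by (induction k) (simp_all add: mult_single flip: single_add)

lemma poly_var_altdef:
  "poly p (single (single n 1) (1::int)) = (\<Sum>i\<le>degree p. coeff p i * single (single n i) 1)"
  unfolding poly_altdef by (simp only: single_var_power)

lemma lookup_poly_var:
  assumes p: "p \<in> polys_over (polys_below n)" and m: "keys m \<subseteq> {..<n}"
  shows "lookup (poly p (single (single n 1) 1)) (m + single n k) = lookup (coeff p k) m"
proof -
  have "lookup (poly p (single (single n 1) 1)) (m + single n k) =
    (\<Sum>i\<le>degree p. if i = k then lookup (coeff p i) m else 0)"
    unfolding poly_var_altdef lookup_sum
    using p m by (intro sum.cong refl lookup_mult_var_power) (auto simp: polys_over_def)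
  also have "\<dots> = lookup (coeff p k) m" by (auto simp: coeff_eq_0)
  finally show ?thesis .
qed

lemma sum_singles: "(\<Sum>m\<in>keys p. single m (lookup p m)) = p"
  by (rule poly_mapping_eqI)
    (auto simp: lookup_sum lookup_single when_def in_keys_iff sum.delta)

text \<open>The step of the induction on the number of variables: substituting the new variable
  turns univariate polynomials over the old ring into the ring with one more variable, inside the
  same type.\<close>

lemma polys_below_Suc:
  "polys_below (Suc n) = (\<lambda>p. poly p (single (single n 1) 1)) ` polys_over (polys_below n)"
    (is "_ = ?\<phi> ` ?S")
proof (intro equalityI subsetI)
  interpret R: subdomain "polys_below n" by (rule subdomain_polys_below)
  interpret R': subdomain "polys_below (Suc n)" by (rule subdomain_polys_below)
  interpret S: subdomain ?S by (rule R.subdomain_polys_over)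
  fix p assume "p \<in> ?\<phi> ` ?S"
  then obtain q where q: "q \<in> ?S" "p = ?\<phi> q" by auto
  have "coeff q i \<in> polys_below (Suc n)" for i
    using q(1) unfolding polys_over_def polys_below_def by fastforce
  moreover have "single (single n i) 1 \<in> polys_below (Suc n)" for i
    by (auto simp: polys_below_def)
  ultimately show "p \<in> polys_below (Suc n)"
    unfolding q(2) poly_var_altdef by (intro R'.sum_mem R'.mult_mem)
next
  interpret R: subdomain "polys_below n" by (rule subdomain_polys_below)
  interpret S: subdomain ?S by (rule R.subdomain_polys_over)
  fix p assume p: "p \<in> polys_below (Suc n)"
  \<comment> \<open>\<open>del\<close> strips the last variable from a monomial; the removed
    exponent becomes the univariate exponent.\<close>
  define del where "del m = m - single n (lookup m n)" for m :: monom
  have split: "m = del m + single n (lookup m n)" for m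
    by (rule poly_mapping_eqI) (auto simp: del_def lookup_add lookup_minus lookup_single when_def)
  have del: "keys (del m) \<subseteq> {..<n}" if "m \<in> keys p" for m
  proof
    fix i assume i: "i \<in> keys (del m)"
    have "i \<noteq> n" "i \<in> keys m" using i
      by (auto simp: del_def in_keys_iff lookup_minus)
    then show "i \<in> {..<n}" using p that by (force simp: polys_below_def)
  qed
  define q where "q = (\<Sum>m\<in>keys p. monom (single (del m) (lookup p m)) (lookup m n))"
  have "q \<in> ?S" unfolding q_def
    using del by (intro S.sum_mem R.monom_mem) (auto simp: polys_below_def)
  moreover have "?\<phi> q = p"
  proof -
    have "?\<phi> q = (\<Sum>m\<in>keys p. single (del m) (lookup p m) * single (single n (lookup m n)) 1)"
      unfolding q_def poly_sum poly_monom by (simp only: single_var_power)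
    also have "\<dots> = (\<Sum>m\<in>keys p. single m (lookup p m))"
      by (simp add: mult_single flip: split)
    finally show ?thesis by (simp add: sum_singles)
  qed
  ultimately show "p \<in> ?\<phi> ` ?S" by auto
qed

lemma inj_on_poly_var:
  "inj_on (\<lambda>p. poly p (single (single n 1) 1)) (polys_over (polys_below n))"
proof (rule inj_onI)
  fix p q assume p: "p \<in> polys_over (polys_below n)" and q: "q \<in> polys_over (polys_below n)"
    and eq: "poly p (single (single n 1) 1) = poly q (single (single n 1) 1)"
  show "p = q"
  proof (rule poly_eqI, rule poly_mapping_eqI)
    fix i m
    show "lookup (coeff p i) m = lookup (coeff q i) m"
    proof (cases "keys m \<subseteq> {..<n}")
      case True
      then show ?thesis using eq lookup_poly_var[OF p] lookup_poly_var[OF q] by metis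
    next
      case False
      moreover have "coeff p i \<in> polys_below n" "coeff q i \<in> polys_below n"
        using p q by (auto simp: polys_over_def)
      ultimately show ?thesis using polys_belowD by metis
    qed
  qed
qed

lemma polys_below_0: "polys_below 0 = range (single 0)"
proof (intro equalityI subsetI)
  fix p assume "p \<in> polys_below 0"
  then have "keys p \<subseteq> {0}" by (auto simp: polys_below_def)
  then have "p = single 0 (lookup p 0)"
    by (intro poly_mapping_eqI) (auto simp: lookup_single when_def in_keys_iff)
  then show "p \<in> range (single 0)" by blast
qed (auto simp: polys_below_def split: if_splits)

lemma factorial_polys_below: "factorial_set (polys_below n)"
proof (induction n)
  case 0
  have "subdomain (UNIV :: int set)" by unfold_locales auto
  then show ?case unfolding polys_below_0
    by (rule factorial_set_transport) (auto simp: mult_single factorial_int)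
next
  case (Suc n)
  interpret R: factorial_subdomain "polys_below n"
    using Suc subdomain_polys_below by (simp add: factorial_subdomain_def factorial_subdomain_axioms_def)
  show ?case unfolding polys_below_Suc
    by (rule factorial_set_transport[OF R.subdomain_polys_over inj_on_poly_var _ _ _ R.factorial_polys_over])
      simp_all
qed

section \<open>Degrees and truncations\<close>

lemma polys_belowI: "(\<And>m. lookup p m \<noteq> 0 \<Longrightarrow> keys m \<subseteq> {..<n}) \<Longrightarrow> p \<in> polys_below n"
  by (simp add: polys_below_def flip: lookup_not_eq_zero_eq_in_keys)

lemma mdeg_add: "mdeg (a + b) = mdeg a + mdeg b"
  unfolding mdeg_def by (rule setsum_keys_plus_distrib) auto

lemma mdeg_eq_0_iff: "mdeg m = 0 \<longleftrightarrow> m = 0"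
  by (auto simp: mdeg_def in_keys_iff intro!: poly_mapping_eqI)

lemma lookup_le_mdeg: "lookup m i \<le> mdeg m"
proof (cases "i \<in> keys m")
  case True then show ?thesis unfolding mdeg_def by (intro member_le_sum) auto
next
  case False then show ?thesis by (simp add: in_keys_iff)
qed

text \<open>Total degree, with value 0 for the zero polynomial; additivity on products is therefore
  stated for nonzero factors.\<close>

definition tdeg :: "(monom \<Rightarrow>\<^sub>0 int) \<Rightarrow> nat" where
  "tdeg p = Max (insert 0 (mdeg ` keys p))"

lemma mdeg_le_tdeg: "lookup p m \<noteq> 0 \<Longrightarrow> mdeg m \<le> tdeg p"
  by (auto simp: tdeg_def in_keys_iff intro!: Max_ge)

lemma tdeg_le_iff: "tdeg p \<le> d \<longleftrightarrow> (\<forall>m. lookup p m \<noteq> 0 \<longrightarrow> mdeg m \<le> d)"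
  by (auto simp: tdeg_def in_keys_iff)

lemma tdeg_attained:
  assumes "p \<noteq> 0" obtains m where "lookup p m \<noteq> 0" "mdeg m = tdeg p"
proof -
  have "keys p \<noteq> {}" using assms by simp
  then have "tdeg p = Max (mdeg ` keys p)" by (simp add: tdeg_def)
  also have "\<dots> \<in> mdeg ` keys p" using \<open>keys p \<noteq> {}\<close> by (intro Max_in) auto
  finally show thesis using that by (auto simp: in_keys_iff)
qed

text \<open>The homogeneous parts of top degree have a nonzero product, since there are no zero
  divisors, and in degree \<open>tdeg p + tdeg q\<close> this product agrees with that of p and
  q.\<close>

lemma tdeg_mult:
  assumes "p \<noteq> 0" "q \<noteq> 0" shows "tdeg (p * q) = tdeg p + tdeg q"
proof (rule antisym)
  show "tdeg (p * q) \<le> tdeg p + tdeg q"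
    unfolding tdeg_le_iff
  proof (intro allI impI)
    fix m assume "lookup (p * q) m \<noteq> 0"
    then obtain a b where "a \<in> keys p" "b \<in> keys q" "m = a + b"
      using keys_mult[of p q] by (auto simp: in_keys_iff)
    then show "mdeg m \<le> tdeg p + tdeg q"
      using mdeg_le_tdeg[of p a] mdeg_le_tdeg[of q b] by (simp add: mdeg_add in_keys_iff)
  qed
  define top where "top r = (\<Sum>m\<in>{m\<in>keys r. mdeg m = tdeg r}. single m (lookup r m))"
    for r :: "monom \<Rightarrow>\<^sub>0 int"
  have top: "lookup (top r) m = (if mdeg m = tdeg r then lookup r m else 0)" for r m
    unfolding top_def lookup_sum lookup_single when_def
    by (subst sum.delta) (auto simp: in_keys_iff)
  have "top r \<noteq> 0" if "r \<noteq> 0" for r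
    using tdeg_attained[OF that] top by (metis lookup_zero)
  then have "top p * top q \<noteq> 0" using assms by simp
  then obtain m where m: "lookup (top p * top q) m \<noteq> 0"
    by (metis lookup_zero poly_mapping_eqI)
  then obtain a b where "a \<in> keys (top p)" "b \<in> keys (top q)" "m = a + b"
    using keys_mult[of "top p" "top q"] by (auto simp: in_keys_iff)
  then have deg: "mdeg m = tdeg p + tdeg q" by (auto simp: in_keys_iff top mdeg_add split: if_splits)
  \<comment> \<open>If both coefficients in a term are nonzero, neither degree exceeds its maximum;
    as the degrees add up to the sum of the maxima, both are attained.\<close>
  have "lookup (top p * top q) m = lookup (p * q) m"
    unfolding kmul_lookup[symmetric] kmul_def
  proof (intro sum.cong refl)
    fix x assume "x \<in> {(a, b). a + b = m}"
    then obtain a b where x: "x = (a, b)" "mdeg a + mdeg b = tdeg p + tdeg q"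
      using deg by (auto simp: mdeg_add)
    show "lookup (top p) (fst x) * lookup (top q) (snd x) = lookup p (fst x) * lookup q (snd x)"
      using x mdeg_le_tdeg[of p a] mdeg_le_tdeg[of q b]
      by (cases "lookup p a = 0"; cases "lookup q b = 0") (auto simp: top)
  qed
  then have "mdeg m \<le> tdeg (p * q)" using m by (intro mdeg_le_tdeg) simp
  then show "tdeg p + tdeg q \<le> tdeg (p * q)" using deg by simp
qed

lemma tdeg_uminus [simp]: "tdeg (- p) = tdeg p"
  by (simp add: tdeg_def)

lemma tdeg_one [simp]: "tdeg 1 = 0"
  by (simp add: tdeg_def mdeg_def)

lemma tdeg_0_const:
  assumes "tdeg p = 0" obtains c where "p = single 0 c"
proof -
  have "lookup p m = 0" if "m \<noteq> 0" for m
    using mdeg_le_tdeg[of p m] assms that mdeg_eq_0_iff[of m] by auto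
  then have "p = single 0 (lookup p 0)"
    by (intro poly_mapping_eqI) (auto simp: lookup_single when_def)
  then show thesis by (rule that)
qed

lemma tdeg_prod_list: "0 \<notin> set ps \<Longrightarrow> tdeg (prod_list ps) = sum_list (map tdeg ps)"
  by (induction ps) (auto simp: tdeg_mult prod_list_zero_iff)

text \<open>Degrees add up over a product, so termwise inequalities with equal sums are equalities.
  Applied to truncation and to shift, this shows that no single factor loses degree.\<close>

lemma tdeg_eq_of_prod_list:
  assumes "prod_list (map \<phi> xs) \<noteq> 0" "prod_list (map \<psi> xs) \<noteq> 0"
    and "tdeg (prod_list (map \<phi> xs)) = tdeg (prod_list (map \<psi> xs))"
    and le: "\<And>x. x \<in> set xs \<Longrightarrow> tdeg (\<phi> x) \<le> tdeg (\<psi> x)"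
    and "x \<in> set xs"
  shows "tdeg (\<phi> x) = tdeg (\<psi> x)"
proof -
  have "sum_list (map (\<lambda>x. tdeg (\<phi> x)) xs) = sum_list (map (\<lambda>x. tdeg (\<psi> x)) xs)"
    using assms(1-3) by (simp add: tdeg_prod_list prod_list_zero_iff o_def)
  then show ?thesis using le \<open>x \<in> set xs\<close>
  proof (induction xs)
    case (Cons y ys)
    have "sum_list (map (\<lambda>x. tdeg (\<phi> x)) ys) \<le> sum_list (map (\<lambda>x. tdeg (\<psi> x)) ys)"
      using Cons.prems(2) by (intro sum_list_mono) auto
    moreover have "tdeg (\<phi> y) \<le> tdeg (\<psi> y)" using Cons.prems(2) by auto
    ultimately have "tdeg (\<phi> y) = tdeg (\<psi> y)"
      "sum_list (map (\<lambda>x. tdeg (\<phi> x)) ys) = sum_list (map (\<lambda>x. tdeg (\<psi> x)) ys)"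
      using Cons.prems(1) by simp_all
    then show ?case using Cons by auto
  qed simp
qed

lemma runit_polys_below: "runit (polys_below n) u \<longleftrightarrow> u = 1 \<or> u = - 1"
proof
  interpret subdomain "polys_below n" by (rule subdomain_polys_below)
  show "runit (polys_below n) u" if "u = 1 \<or> u = - 1"
    using that by (auto simp: runit_def rdvd_def intro: bexI[of _ u])
  assume "runit (polys_below n) u"
  then obtain v where uv: "u * v = 1" by (auto simp: runit_def rdvd_def)
  then have "u \<noteq> 0" "v \<noteq> 0" by auto
  then have "tdeg u = 0" "tdeg v = 0" using tdeg_mult[of u v] uv by auto
  then obtain c d where cd: "u = single 0 c" "v = single 0 d" by (metis tdeg_0_const)
  then have "single 0 (c * d) = (single 0 1 :: monom \<Rightarrow>\<^sub>0 int)" using uv by (simp add: mult_single)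
  then have "c * d = 1" by (metis lookup_single_eq)
  then have "c = 1 \<or> c = - 1" by (auto simp: zmult_eq_1_iff)
  then show "u = 1 \<or> u = - 1" using cd by (auto simp: single_uminus)
qed

text \<open>For a series outside K the function below may have infinite support, and \<open>trunc\<close> is then
  unspecified.\<close>

definition trunc :: "nat \<Rightarrow> series \<Rightarrow> (monom \<Rightarrow>\<^sub>0 int)" where
  "trunc n f = Abs_poly_mapping (\<lambda>m. if keys m \<subseteq> {..<n} then f m else 0)"

lemma finite_bounded_monoms: "finite {m. keys m \<subseteq> {..<n} \<and> mdeg m \<le> d}"
proof -
  let ?F = "{f. \<forall>i. (i \<in> {..<n} \<longrightarrow> f i \<in> {..d}) \<and> (i \<notin> {..<n} \<longrightarrow> f i = 0)}"
  have "finite ?F" by (rule finite_set_of_finite_funs) auto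
  moreover have "lookup ` {m. keys m \<subseteq> {..<n} \<and> mdeg m \<le> d} \<subseteq> ?F"
  proof (intro image_subsetI CollectI allI conjI impI)
    fix m i assume m: "m \<in> {m. keys m \<subseteq> {..<n} \<and> mdeg m \<le> d}"
    show "lookup m i \<in> {..d}" using lookup_le_mdeg[of m i] m by simp
    assume "i \<notin> {..<n}"
    then show "lookup m i = 0" using m by (auto simp: in_keys_iff)
  qed
  ultimately have "finite (lookup ` {m. keys m \<subseteq> {..<n} \<and> mdeg m \<le> d})"
    by (rule finite_subset[rotated])
  then show ?thesis by (rule finite_imageD) (auto simp: inj_on_def lookup_inject)
qed

lemma lookup_trunc:
  assumes "f \<in> K" shows "lookup (trunc n f) m = (if keys m \<subseteq> {..<n} then f m else 0)"
proof -
  obtain d where "\<forall>m. f m \<noteq> 0 \<longrightarrow> mdeg m \<le> d" using assms by (auto simp: K_def)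
  then have "finite {m. (if keys m \<subseteq> {..<n} then f m else 0) \<noteq> 0}"
    by (intro finite_subset[OF _ finite_bounded_monoms[of n d]]) auto
  then show ?thesis unfolding trunc_def by (simp add: Abs_poly_mapping_inverse)
qed

lemma trunc_mem: "f \<in> K \<Longrightarrow> trunc n f \<in> polys_below n"
  by (rule polys_belowI) (simp add: lookup_trunc split: if_splits)

lemma lookup_in_K: "lookup p \<in> K"
  using mdeg_le_tdeg by (auto simp: K_def)

section \<open>Truncation as a ring homomorphism\<close>

lemma kmul_in_K:
  assumes "f \<in> K" "g \<in> K" shows "kmul f g \<in> K"
proof -
  obtain d e where d: "\<And>m. f m \<noteq> 0 \<Longrightarrow> mdeg m \<le> d" and e: "\<And>m. g m \<noteq> 0 \<Longrightarrow> mdeg m \<le> e"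
    using assms by (auto simp: K_def)
  have "mdeg m \<le> d + e" if nz: "kmul f g m \<noteq> 0" for m
  proof -
    obtain p where "p \<in> {(a, b). a + b = m}" "f (fst p) * g (snd p) \<noteq> 0"
      using sum.not_neutral_contains_not_neutral[OF nz[unfolded kmul_def]] by blast
    then obtain a b where "a + b = m" "f a * g b \<noteq> 0" by auto
    then show ?thesis using d[of a] e[of b] by (auto simp: mdeg_add)
  qed
  then show ?thesis by (auto simp: K_def)
qed

lemma keys_add_monom: "keys ((a :: monom) + b) = keys a \<union> keys b"
  by (auto simp: in_keys_iff lookup_add)

lemma trunc_kmul:
  assumes "f \<in> K" "g \<in> K" shows "trunc n (kmul f g) = trunc n f * trunc n g"
proof (rule poly_mapping_eqI)
  fix m
  have "lookup (trunc n f * trunc n g) m =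
    (\<Sum>p\<in>{(a, b). a + b = m}. if keys m \<subseteq> {..<n} then f (fst p) * g (snd p) else 0)"
    unfolding kmul_lookup[symmetric] kmul_def
    using assms by (intro sum.cong) (auto simp: lookup_trunc keys_add_monom)
  also have "\<dots> = lookup (trunc n (kmul f g)) m"
    using assms by (simp add: lookup_trunc kmul_in_K) (simp add: kmul_def)
  finally show "lookup (trunc n (kmul f g)) m = lookup (trunc n f * trunc n g) m" by simp
qed

lemma kone_in_K: "kone \<in> K"
  by (auto simp: K_def kone_def intro!: exI[of _ 0] simp: mdeg_def split: if_splits)

lemma trunc_kone [simp]: "trunc n kone = 1"
  by (rule poly_mapping_eqI, simp add: lookup_trunc kone_in_K, auto simp: kone_def lookup_one when_def)

lemma kprod_in_K: "set fs \<subseteq> K \<Longrightarrow> kprod fs \<in> K"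
  by (induction fs) (auto simp: kprod_def kone_in_K kmul_in_K)

lemma trunc_kprod: "set fs \<subseteq> K \<Longrightarrow> trunc n (kprod fs) = prod_list (map (trunc n) fs)"
proof (induction fs)
  case (Cons g fs)
  then have "trunc n (kmul g (kprod fs)) = trunc n g * trunc n (kprod fs)"
    by (intro trunc_kmul kprod_in_K) auto
  then show ?case using Cons by (simp add: kprod_def)
qed (simp add: kprod_def)

lemma trunc_trunc: "f \<in> K \<Longrightarrow> n \<le> n' \<Longrightarrow> trunc n (lookup (trunc n' f)) = trunc n f"
  by (rule poly_mapping_eqI) (auto simp: lookup_trunc lookup_in_K subset_iff)

lemma trunc_lookup: "p \<in> polys_below n \<Longrightarrow> trunc n (lookup p) = p"
  by (rule poly_mapping_eqI) (auto simp: lookup_trunc lookup_in_K polys_below_def in_keys_iff)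

lemma trunc_mult: "trunc n (lookup (p * q)) = trunc n (lookup p) * trunc n (lookup q)"
  by (simp add: trunc_kmul lookup_in_K flip: kmul_lookup)

lemma trunc_uminus: "f \<in> K \<Longrightarrow> trunc n (- f) = - trunc n f"
  by (rule poly_mapping_eqI) (subst lookup_trunc, auto simp: lookup_trunc K_def)

lemma lookup_uminus_fun: "lookup (- p) = - lookup (p :: monom \<Rightarrow>\<^sub>0 int)"
  by (simp add: fun_eq_iff)

lemma lookup_one_kone: "lookup 1 = kone"
  by (auto simp: kone_def lookup_one when_def fun_eq_iff)

lemma trunc_prod_list:
  "trunc n (lookup (prod_list ps)) = prod_list (map (\<lambda>p. trunc n (lookup p)) ps)"
  by (induction ps) (simp_all add: lookup_one_kone trunc_mult)

lemma keys_subset_bound: obtains n where "N \<le> n" "keys (m :: monom) \<subseteq> {..<n}"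
proof -
  have "keys m \<subseteq> {..<Suc (Max (insert N (keys m)))}"
    by (auto simp: less_Suc_eq_le intro: Max_ge)
  moreover have "N \<le> Suc (Max (insert N (keys m)))" by (simp add: le_SucI)
  ultimately show thesis using that by blast
qed

lemma K_eqI:
  assumes "f \<in> K" "g \<in> K" "\<And>n. n \<ge> N \<Longrightarrow> trunc n f = trunc n g"
  shows "f = g"
proof
  fix m :: monom
  obtain n where n: "N \<le> n" "keys m \<subseteq> {..<n}" by (rule keys_subset_bound[of N m])
  have "lookup (trunc n f) m = lookup (trunc n g) m" using assms(3) n by simp
  then show "f m = g m" using assms(1,2) n by (simp add: lookup_trunc)
qed

lemma tdeg_trunc_le: "tdeg (trunc n (lookup p)) \<le> tdeg p"
  by (auto simp: tdeg_le_iff lookup_trunc lookup_in_K mdeg_le_tdeg)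

text \<open>The degrees of the truncations increase weakly with n and are bounded, because f has
  bounded degree. Every monomial of f occurs in some truncation, so the final value also bounds
  f.\<close>

lemma tdeg_trunc_stable:
  assumes f: "f \<in> K" obtains N d where "\<And>n. n \<ge> N \<Longrightarrow> tdeg (trunc n f) = d"
    "\<And>m. f m \<noteq> 0 \<Longrightarrow> mdeg m \<le> d"
proof -
  obtain e where e: "\<forall>m. f m \<noteq> 0 \<longrightarrow> mdeg m \<le> e" using f by (auto simp: K_def)
  then have "tdeg (trunc n f) \<le> e" for n using f by (auto simp: tdeg_le_iff lookup_trunc)
  then obtain N where N: "\<And>n. tdeg (trunc n f) \<le> tdeg (trunc N f)"
    using ex_has_greatest_nat[of "\<lambda>_. True" 0 "\<lambda>n. tdeg (trunc n f)" "Suc e"]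
    by (auto simp: less_Suc_eq_le)
  have "tdeg (trunc n f) = tdeg (trunc N f)" if "n \<ge> N" for n
    using N[of n] tdeg_trunc_le[of N "trunc n f"] trunc_trunc[OF f that] by simp
  moreover have "mdeg m \<le> tdeg (trunc N f)" if "f m \<noteq> 0" for m
  proof -
    obtain n where "keys m \<subseteq> {..<n}" by (rule keys_subset_bound[of 0 m])
    then have "mdeg m \<le> tdeg (trunc n f)" using that f by (intro mdeg_le_tdeg) (simp add: lookup_trunc)
    then show ?thesis using N le_trans by blast
  qed
  ultimately show thesis using that by blast
qed

text \<open>An inverse limit. The uniform degree bound is what puts the limit into K.\<close>

lemma coherent_limit:
  assumes mem: "\<And>n. n \<ge> N \<Longrightarrow> A n \<in> polys_below n"
    and step: "\<And>n. n \<ge> N \<Longrightarrow> trunc n (lookup (A (Suc n))) = A n"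
    and bound: "\<And>n. n \<ge> N \<Longrightarrow> tdeg (A n) \<le> d"
  obtains a where "a \<in> K" "\<And>n. n \<ge> N \<Longrightarrow> trunc n a = A n"
proof -
  have coherent: "trunc n (lookup (A n')) = A n" if "N \<le> n" "n \<le> n'" for n n'
    using that(2)
  proof (induction n' rule: dec_induct)
    case base
    then show ?case using that mem trunc_lookup by blast
  next
    case (step k)
    have "trunc n (lookup (trunc k (lookup (A (Suc k))))) = A n"
      using step assms(2)[of k] that by simp
    then show ?case using trunc_trunc[OF lookup_in_K] step by simp
  qed
  then have indep: "lookup (A n') m = lookup (A n) m"
    if "N \<le> n" "n \<le> n'" "keys m \<subseteq> {..<n}" for n n' m
    using that lookup_trunc[OF lookup_in_K, of n "A n'" m] by simp
  \<comment> \<open>Any n that sees all variables of m would do; by coherence the coefficient of m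
    does not depend on the choice.\<close>
  define bd where "bd m = (SOME n. N \<le> n \<and> keys m \<subseteq> {..<n})" for m :: monom
  have bd: "N \<le> bd m" "keys m \<subseteq> {..<bd m}" for m
    using someI_ex[of "\<lambda>n. N \<le> n \<and> keys m \<subseteq> {..<n}"] keys_subset_bound[of N m] bd_def by metis+
  define a where "a m = lookup (A (bd m)) m" for m
  have a: "a m = lookup (A n) m" if "N \<le> n" "keys m \<subseteq> {..<n}" for n m
    using indep[of n "bd m" m] indep[of "bd m" n m] that bd[of m] unfolding a_def
    by (cases "n \<le> bd m") auto
  have "a \<in> K" unfolding K_def a_def
    using mdeg_le_tdeg bound[OF bd(1)] le_trans by blast
  moreover have "trunc n a = A n" if "n \<ge> N" for n
    using \<open>a \<in> K\<close> a[OF that] mem[OF that]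
    by (intro poly_mapping_eqI) (auto simp: lookup_trunc polys_below_def in_keys_iff)
  ultimately show thesis using that by blast
qed

lemma K_unit_trunc: "K_unit u \<Longrightarrow> runit (polys_below n) (trunc n u)"
  unfolding K_unit_def runit_def rdvd_def by (metis trunc_kmul trunc_kone trunc_mem)

text \<open>Units have degree 0, so here \<open>a\<close> would be a constant, and truncation leaves
  constants alone.\<close>

lemma not_runit_of_tdeg_eq:
  assumes a: "\<not> runit (polys_below n') a" and deg: "tdeg (trunc n (lookup a)) = tdeg a"
  shows "\<not> runit (polys_below n) (trunc n (lookup a))"
proof
  assume *: "runit (polys_below n) (trunc n (lookup a))"
  then have "tdeg a = 0" using deg by (auto simp: runit_polys_below)
  then obtain c where c: "a = single 0 c" by (rule tdeg_0_const)
  then have "trunc n (lookup a) = a" by (intro trunc_lookup) (auto simp: polys_below_def)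
  then show False using a * by (simp add: runit_polys_below)
qed

section \<open>Truncations of irreducible elements\<close>

text \<open>Once the degree is stable, the primes at level n + 1 restrict to nonunits at level n, so
  the number of primes cannot grow with n. Where it is constant, each prime at level n is, up to
  sign, the restriction of one at level n + 1. The limit of such a chain is a nonunit factor of p,
  so its cofactor is a unit, and the truncations of p are associates of the primes in the
  chain.\<close>

lemma K_irreducible_eventually_rprime:
  assumes p: "K_irreducible p"
  obtains N where "\<And>n. n \<ge> N \<Longrightarrow> rprime (polys_below n) (trunc n p)"
proof -
  define P where "P n = trunc n p" for n
  define r where "r n q = trunc n (lookup q)" for n and q :: "monom \<Rightarrow>\<^sub>0 int"
  have pK: "p \<in> K" and p0: "p \<noteq> kzero" and p_nonunit: "\<not> K_unit p"
    using p by (auto simp: K_irreducible_def)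
  have P_mem: "P n \<in> polys_below n" for n using pK by (simp add: P_def trunc_mem)
  have r_mem: "r n q \<in> polys_below n" for n q by (simp add: r_def trunc_mem lookup_in_K)
  have r_mult: "r n (a * b) = r n a * r n b" for n a b by (simp add: r_def trunc_mult)
  have r_uminus: "r n (- a) = - r n a" for n a
    by (simp add: r_def lookup_uminus_fun trunc_uminus lookup_in_K)
  have r_one: "r n 1 = 1" for n by (simp add: r_def lookup_one_kone)
  have r_P: "r n (P (Suc n)) = P n" for n by (simp add: r_def P_def trunc_trunc pK)
  obtain N0 d where d: "\<And>n. n \<ge> N0 \<Longrightarrow> tdeg (P n) = d"
    using tdeg_trunc_stable[OF pK] unfolding P_def by metis
  obtain m0 where m0: "p m0 \<noteq> 0" using p0 by (auto simp: kzero_def fun_eq_iff)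
  obtain N1 where N1: "N0 \<le> N1" "keys m0 \<subseteq> {..<N1}" by (rule keys_subset_bound[of N0 m0])
  have P_nz: "P n \<noteq> 0" if "n \<ge> N1" for n
  proof -
    have "keys m0 \<subseteq> {..<n}" using N1 that by auto
    then have "lookup (P n) m0 \<noteq> 0" using m0 pK by (simp add: P_def lookup_trunc)
    then show ?thesis by auto
  qed
  have "\<exists>u ps. runit (polys_below n) u \<and> (\<forall>q\<in>set ps. rprime (polys_below n) q) \<and>
      P n = u * prod_list ps" if "n \<ge> N1" for n
    using factorial_polys_below[of n] P_mem P_nz[OF that] unfolding factorial_set_def by blast
  then obtain U L where
    U: "\<And>n. n \<ge> N1 \<Longrightarrow> runit (polys_below n) (U n)" and
    L: "\<And>n. n \<ge> N1 \<Longrightarrow> \<forall>q\<in>set (L n). rprime (polys_below n) q" and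
    PL: "\<And>n. n \<ge> N1 \<Longrightarrow> P n = U n * prod_list (L n)"
    by metis
  have match: "length (L (Suc n)) \<le> length (L n) \<and> (length (L (Suc n)) = length (L n) \<longrightarrow>
      (\<forall>q\<in>set (L n). \<exists>q'\<in>set (L (Suc n)). \<exists>v. runit (polys_below n) v \<and> r n q' = v * q))"
    if n: "n \<ge> N1" for n
  proof -
    interpret subdomain "polys_below n" by (rule subdomain_polys_below)
    let ?L = "L (Suc n)"
    have n': "Suc n \<ge> N1" using n by simp
    have u: "r n (U (Suc n)) = 1 \<or> r n (U (Suc n)) = - 1"
      using U[OF n'] by (auto simp: runit_polys_below r_one r_uminus)
    have prod: "r n (prod_list ?L) = prod_list (map (r n) ?L)"
      unfolding r_def by (rule trunc_prod_list)
    have eq: "P n = r n (U (Suc n)) * prod_list (map (r n) ?L)"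
      using r_P[of n] PL[OF n'] by (simp add: r_mult prod)
    \<comment> \<open>Both products have degree d, so each prime factor keeps its degree under
      restriction and cannot become a unit.\<close>
    have deg: "tdeg (r n q) = tdeg q" if "q \<in> set ?L" for q
    proof -
      have "tdeg (prod_list (map (r n) ?L)) = tdeg (P n)"
        unfolding eq using u by auto
      also have "\<dots> = tdeg (P (Suc n))" using d n N1 by simp
      also have "\<dots> = tdeg (prod_list (map (\<lambda>x. x) ?L))"
        using PL[OF n'] U[OF n'] by (auto simp: runit_polys_below)
      finally have degs: "tdeg (prod_list (map (r n) ?L)) = tdeg (prod_list (map (\<lambda>x. x) ?L))" .
      have "prod_list (map (r n) ?L) \<noteq> 0" using eq P_nz[OF n] by (metis mult_zero_right)
      moreover have "prod_list (map (\<lambda>x. x) ?L) \<noteq> 0"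
        using PL[OF n'] P_nz[OF n'] by (metis mult_zero_right list.map_ident)
      ultimately show ?thesis
        by (rule tdeg_eq_of_prod_list[OF _ _ degs _ that]) (simp add: r_def tdeg_trunc_le)
    qed
    have nonunit: "\<forall>q\<in>set (map (r n) ?L). q \<in> polys_below n \<and> \<not> runit (polys_below n) q"
    proof (intro ballI)
      fix x assume "x \<in> set (map (r n) ?L)"
      then obtain q where q: "q \<in> set ?L" "x = r n q" by auto
      have "\<not> runit (polys_below (Suc n)) q" using L[OF n'] q by (auto simp: rprime_def)
      then have "\<not> runit (polys_below n) (r n q)"
        using not_runit_of_tdeg_eq[of "Suc n" q n] deg[OF q(1)] by (simp add: r_def)
      then show "x \<in> polys_below n \<and> \<not> runit (polys_below n) x" using q(2) r_mem by simp
    qed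
    have un: "runit (polys_below n) (r n (U (Suc n)) * U n)"
      using u U[OF n] by (auto simp: runit_polys_below)
    have "r n (U (Suc n)) * r n (U (Suc n)) = 1" using u by auto
    then have "prod_list (map (r n) ?L) = r n (U (Suc n)) * P n"
      unfolding eq by (simp flip: mult.assoc)
    then have "prod_list (map (r n) ?L) = r n (U (Suc n)) * U n * prod_list (L n)"
      by (simp add: PL[OF n] mult.assoc)
    from prime_list_match[OF un L[OF n] nonunit this] show ?thesis by simp
  qed
  \<comment> \<open>The least number of prime factors is attained at \<open>N2\<close>; since the
    number never grows, it is constant from there on.\<close>
  obtain N2 where N2: "N2 \<ge> N1" and least: "\<And>n. n \<ge> N1 \<Longrightarrow> length (L N2) \<le> length (L n)"
    using ex_has_least_nat[of "\<lambda>n. n \<ge> N1" N1 "\<lambda>n. length (L n)"] by auto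
  have le: "length (L n) \<le> length (L N2)" if "n \<ge> N2" for n
    using that
  proof (induction n rule: dec_induct)
    case (step k)
    then show ?case using match[of k] N2 by linarith
  qed simp
  have len: "length (L n) = length (L N2)" if "n \<ge> N2" for n
    using le[OF that] least[of n] that N2 by simp
  \<comment> \<open>Admitting both signs makes the restriction of a lift equal to the given factor
    on the nose, as a coherent chain demands.\<close>
  define Q where "Q n a \<longleftrightarrow> (\<exists>q\<in>set (L n). a = q \<or> a = - q)" for n a
  have lift: "\<exists>a'. Q (Suc n) a' \<and> r n a' = a" if n: "n \<ge> N2" and a: "Q n a" for n a
  proof -
    obtain q where q: "q \<in> set (L n)" "a = q \<or> a = - q" using a by (auto simp: Q_def)
    have "length (L (Suc n)) = length (L n)" using len[of n] len[of "Suc n"] n by simp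
    then obtain q' v where q': "q' \<in> set (L (Suc n))" "runit (polys_below n) v" "r n q' = v * q"
      using match[of n] q(1) n N2 by fastforce
    then have "r n q' = a \<or> r n (- q') = a"
      using q(2) by (auto simp: runit_polys_below r_uminus)
    then show ?thesis using q'(1) unfolding Q_def by blast
  qed
  have "L N2 \<noteq> []"
  proof
    assume "L N2 = []"
    \<comment> \<open>Each truncation would be 1 or -1; squaring avoids deciding which, and exhibits
      p as its own inverse.\<close>
    then have "P n * P n = 1" if "n \<ge> N2" for n
      using len[OF that] PL[of n] U[of n] that N2 by (auto simp: runit_polys_below)
    then have "kmul p p = kone"
      by (intro K_eqI[of _ _ N2]) (auto simp: kmul_in_K kone_in_K pK trunc_kmul P_def)
    then show False using p_nonunit pK unfolding K_unit_def by blast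
  qed
  \<comment> \<open>Existence at the start and liftability feed dependent choice, which counts from
    0; hence the index \<open>N2 + k\<close>.\<close>
  then have "\<exists>a. Q (N2 + 0) a" unfolding Q_def by (cases "L N2") auto
  moreover have "\<exists>a'. Q (N2 + Suc k) a' \<and> r (N2 + k) a' = a" if "Q (N2 + k) a" for k a
    using lift[OF _ that] by simp
  ultimately obtain f where f: "\<And>k. Q (N2 + k) (f k)" "\<And>k. r (N2 + k) (f (Suc k)) = f k"
    using dependent_nat_choice[of "\<lambda>k. Q (N2 + k)" "\<lambda>k a a'. r (N2 + k) a' = a"] by auto
  define A where "A n = f (n - N2)" for n
  have A_Q: "Q n (A n)" if "n \<ge> N2" for n using f(1)[of "n - N2"] that by (simp add: A_def)
  have A_r: "r n (A (Suc n)) = A n" if "n \<ge> N2" for n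
    using f(2)[of "n - N2"] that by (simp add: A_def Suc_diff_le)
  have A_prime: "rprime (polys_below n) (A n)" if n: "n \<ge> N2" for n
  proof -
    interpret subdomain "polys_below n" by (rule subdomain_polys_below)
    obtain q where q: "rprime (polys_below n) q" "A n = q \<or> A n = - q"
      using A_Q[OF n] L[of n] n N2 unfolding Q_def by auto
    then show ?thesis using rprime_assoc[OF q(1), of "- 1"] by (auto simp: runit_polys_below)
  qed
  have "\<exists>b\<in>polys_below n. P n = A n * b" if n: "n \<ge> N2" for n
  proof -
    interpret subdomain "polys_below n" by (rule subdomain_polys_below)
    have nn: "n \<ge> N1" using n N2 by simp
    obtain q where q: "q \<in> set (L n)" "A n = q \<or> A n = - q" using A_Q[OF n] by (auto simp: Q_def)
    obtain xs ys where split: "L n = xs @ q # ys" using q(1) by (meson split_list)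
    have sub: "set (xs @ ys) \<subseteq> polys_below n" using L[OF nn] split by (auto simp: rprime_def)
    define b where "b = U n * prod_list (xs @ ys)"
    have "b \<in> polys_below n"
      unfolding b_def using U[OF nn] prod_list_mem[OF sub] by (auto simp: runit_def)
    moreover have "P n = q * b" using PL[OF nn] split by (simp add: b_def ac_simps)
    ultimately show ?thesis using q(2) uminus_mem by (metis minus_mult_minus)
  qed
  then obtain B where B: "\<And>n. n \<ge> N2 \<Longrightarrow> B n \<in> polys_below n"
    and PAB: "\<And>n. n \<ge> N2 \<Longrightarrow> P n = A n * B n" by metis
  have nz: "A n \<noteq> 0" "B n \<noteq> 0" if "n \<ge> N2" for n
    using PAB[OF that] P_nz[of n] that N2 by auto
  have deg: "tdeg (A n) \<le> d" "tdeg (B n) \<le> d" if "n \<ge> N2" for n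
    using tdeg_mult[OF nz[OF that]] PAB[OF that] d[of n] that N1 N2 by auto
  \<comment> \<open>Cofactors inherit coherence from \<open>P\<close> and \<open>A\<close> by
    cancelling the nonzero \<open>A n\<close>.\<close>
  have B_r: "r n (B (Suc n)) = B n" if n: "n \<ge> N2" for n
  proof -
    have "A n * r n (B (Suc n)) = A n * B n"
      using r_P[of n] PAB[of "Suc n"] PAB[of n] A_r[OF n] n by (simp add: r_mult)
    then show ?thesis using nz[OF n] by simp
  qed
  have A_mem: "A n \<in> polys_below n" if "n \<ge> N2" for n using A_prime[OF that] by (simp add: rprime_def)
  obtain a where a: "a \<in> K" "\<And>n. n \<ge> N2 \<Longrightarrow> trunc n a = A n"
    using coherent_limit[of N2 A d] A_mem A_r deg(1) unfolding r_def by blast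
  obtain b where b: "b \<in> K" "\<And>n. n \<ge> N2 \<Longrightarrow> trunc n b = B n"
    using coherent_limit[of N2 B d] B B_r deg(2) unfolding r_def by blast
  have "p = kmul a b"
    using PAB a b by (intro K_eqI[of _ _ N2]) (auto simp: pK kmul_in_K trunc_kmul P_def)
  then have "K_unit a \<or> K_unit b" using p a(1) b(1) unfolding K_irreducible_def by blast
  moreover have "\<not> K_unit a"
    using K_unit_trunc[of a N2] A_prime[of N2] a(2)[of N2] by (auto simp: rprime_def)
  ultimately have "K_unit b" by blast
  have "rprime (polys_below n) (trunc n p)" if n: "n \<ge> N2" for n
  proof -
    interpret subdomain "polys_below n" by (rule subdomain_polys_below)
    have "runit (polys_below n) (B n)" using K_unit_trunc[OF \<open>K_unit b\<close>, of n] b(2)[OF n] by simp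
    from rprime_assoc[OF A_prime[OF n] this] show ?thesis
      using PAB[OF n] by (simp add: P_def mult.commute)
  qed
  then show thesis by (rule that)
qed

section \<open>Closing up gaps\<close>

definition skip :: "nat \<Rightarrow> nat \<Rightarrow> nat" where
  "skip j i = (if i < j then i else Suc i)"

lemma strict_mono_skip: "strict_mono (skip j)"
  by (auto simp: strict_mono_def skip_def)

lemma inj_skip: "inj (skip j)"
  by (rule strict_mono_imp_inj_on[OF strict_mono_skip])

text \<open>Relabels variables along \<open>skip j\<close>, expressed by the inverse of
  \<open>skip j\<close> on its image, with exponent 0 at the omitted index j.\<close>

lift_definition push :: "nat \<Rightarrow> monom \<Rightarrow> monom" is
  "\<lambda>j m i. if i < j then m i else if i = j then 0 else m (i - 1)"
proof -
  fix j :: nat and m :: "nat \<Rightarrow> nat" assume fin: "finite {i. m i \<noteq> 0}"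
  have "{i. (if i < j then m i else if i = j then 0 else m (i - 1)) \<noteq> 0} \<subseteq>
    {i. m i \<noteq> 0} \<union> Suc ` {i. m i \<noteq> 0}"
  proof (rule subsetI)
    fix i assume "i \<in> {i. (if i < j then m i else if i = j then 0 else m (i - 1)) \<noteq> 0}"
    then have "m i \<noteq> 0 \<or> (i = Suc (i - 1) \<and> m (i - 1) \<noteq> 0)" by (auto split: if_splits)
    then show "i \<in> {i. m i \<noteq> 0} \<union> Suc ` {i. m i \<noteq> 0}" by blast
  qed
  then show "finite {i. (if i < j then m i else if i = j then 0 else m (i - 1)) \<noteq> 0}"
    by (rule finite_subset) (use fin in auto)
qed

text \<open>A left inverse of \<open>push j\<close>. It discards the exponent at j, so it is a right
  inverse only on monomials without that variable.\<close>

lift_definition pull :: "nat \<Rightarrow> monom \<Rightarrow> monom" is "\<lambda>j m i. m (skip j i)"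
proof -
  fix j :: nat and m :: "nat \<Rightarrow> nat" assume "finite {i. m i \<noteq> 0}"
  from finite_vimageI[OF this inj_skip[of j]] show "finite {i. m (skip j i) \<noteq> 0}"
    by (simp add: vimage_def)
qed

lemma lookup_push:
  "lookup (push j m) i = (if i < j then lookup m i else if i = j then 0 else lookup m (i - 1))"
  by (simp add: push.rep_eq)

lemma lookup_pull: "lookup (pull j m) i = lookup m (skip j i)"
  by (simp add: pull.rep_eq)

lemma lookup_push_skip: "lookup (push j m) (skip j i) = lookup m i"
  by (simp add: lookup_push skip_def)

lemma pull_push: "pull j (push j m) = m"
  by (rule poly_mapping_eqI) (simp add: lookup_pull lookup_push_skip)

lemma skip_cases: obtains "i = j" | k where "i = skip j k"
proof -
  consider "i < j" | "i = j" | "i > j" by linarith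
  then show ?thesis
  proof cases
    case 1
    then have "i = skip j i" by (simp add: skip_def)
    then show ?thesis by (rule that(2))
  next
    case 2
    then show ?thesis by (rule that(1))
  next
    case 3
    then have "i = skip j (i - 1)" by (auto simp: skip_def)
    then show ?thesis by (rule that(2))
  qed
qed

lemma push_pull:
  assumes "j \<notin> keys m" shows "push j (pull j m) = m"
proof (rule poly_mapping_eqI)
  fix i
  show "lookup (push j (pull j m)) i = lookup m i"
  proof (cases rule: skip_cases[of i j])
    case 1
    then show ?thesis using assms by (simp add: lookup_push in_keys_iff)
  next
    case (2 k)
    then show ?thesis by (simp add: lookup_push_skip lookup_pull)
  qed
qed

lemma push_add: "push j (a + b) = push j a + push j b"
  by (rule poly_mapping_eqI) (simp add: lookup_push lookup_add)

lemma push_zero [simp]: "push j 0 = 0"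
  by (rule poly_mapping_eqI) (simp add: lookup_push)

lemma push_eq_iff [simp]: "push j a = push j b \<longleftrightarrow> a = b"
  by (metis pull_push)

lemma keys_push: "keys (push j m) = skip j ` keys m"
proof (intro equalityI subsetI)
  fix i assume i: "i \<in> keys (push j m)"
  show "i \<in> skip j ` keys m"
  proof (cases rule: skip_cases[of i j])
    case 1
    then have "lookup (push j m) i = 0" by (simp add: lookup_push)
    then show ?thesis using i unfolding in_keys_iff by blast
  next
    case (2 k)
    then have "k \<in> keys m" using i lookup_push_skip[of j m k] unfolding in_keys_iff by metis
    then show ?thesis using 2 by blast
  qed
next
  fix i assume "i \<in> skip j ` keys m"
  then obtain k where "i = skip j k" "k \<in> keys m" by blast
  then show "i \<in> keys (push j m)" using lookup_push_skip[of j m k] unfolding in_keys_iff by metis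
qed

lemma push_id:
  assumes "keys m \<subseteq> {..<j}" shows "push j m = m"
proof (rule poly_mapping_eqI)
  have "lookup m i = 0" if "i \<ge> j" for i using assms that by (auto simp: in_keys_iff)
  then show "lookup (push j m) i = lookup m i" for i by (simp add: lookup_push)
qed

text \<open>Either way the gaps end up at j and j + 1: a second gap at j moves the first one to j +
  1.\<close>

lemma push_push: "push (Suc j) (push j m) = push j (push j m)"
  by (rule poly_mapping_eqI) (simp add: lookup_push)

lemma mdeg_push: "mdeg (push j m) = mdeg m"
  unfolding mdeg_def keys_push
  by (subst sum.reindex) (auto simp: lookup_push_skip intro: inj_on_subset[OF inj_skip])

text \<open>Since \<open>skip j\<close> is strictly increasing, it maps the sorted list of variables
  to the sorted list of their images, and the exponents keep their order.\<close>

lemma exps_push: "exps (push j m) = exps m"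
proof -
  let ?xs = "sorted_list_of_set (keys m)"
  have "sorted_wrt (<) (map (skip j) ?xs)"
    using strict_mono_skip[of j] by (auto simp: sorted_wrt_map strict_mono_def intro: sorted_wrt_mono_rel[OF _ strict_sorted_list_of_set])
  then have "sorted_list_of_set (set (map (skip j) ?xs)) = map (skip j) ?xs"
    by (intro sorted_list_of_set.idem_if_sorted_distinct) (auto simp: strict_sorted_iff)
  then show ?thesis by (simp add: exps_def keys_push lookup_push_skip)
qed

text \<open>Coefficient form of setting the variable with index j to zero and renumbering the later
  ones: \<open>push j m\<close> is the only monomial without that variable that closes up to
  m.\<close>

definition shift :: "nat \<Rightarrow> series \<Rightarrow> series" where
  "shift j f = (\<lambda>m. f (push j m))"

lemma shift_bound: "(\<And>m. f m \<noteq> 0 \<Longrightarrow> mdeg m \<le> d) \<Longrightarrow> shift j f m \<noteq> 0 \<Longrightarrow> mdeg m \<le> d"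
  unfolding shift_def by (metis mdeg_push)

lemma shift_in_K: "f \<in> K \<Longrightarrow> shift j f \<in> K"
  unfolding K_def using shift_bound by blast

lemma shift_uminus: "shift j (- f) = - shift j f"
  by (simp add: shift_def fun_eq_iff)

lemma shift_shift: "shift j (shift (Suc j) f) = shift j (shift j f)"
  by (simp add: shift_def push_push)

lemma shift_kone: "shift j kone = kone"
proof -
  have "push j m = 0 \<longleftrightarrow> m = 0" for m using push_eq_iff[of j m 0] by simp
  then show ?thesis by (simp add: shift_def kone_def fun_eq_iff)
qed

text \<open>Divisors of a monomial without the variable j lack it too, so \<open>push j\<close> and
  \<open>pull j\<close> match the splittings of m with those of \<open>push j m\<close>.\<close>

lemma shift_kmul: "shift j (kmul f g) = kmul (shift j f) (shift j g)"
proof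
  fix m
  have "bij_betw (\<lambda>(a, b). (push j a, push j b)) {(a, b). a + b = m} {(a, b). a + b = push j m}"
  proof (rule bij_betw_byWitness[where f' = "\<lambda>(a, b). (pull j a, pull j b)"])
    have *: "j \<notin> keys a" "j \<notin> keys b" if "a + b = push j m" for a b
      using that[symmetric] keys_push[of j m] by (auto simp: keys_add_monom skip_def)
    then show "\<forall>x\<in>{(a, b). a + b = push j m}.
      (case case x of (a, b) \<Rightarrow> (pull j a, pull j b) of (a, b) \<Rightarrow> (push j a, push j b)) = x"
      by (auto simp: push_pull)
    have "pull j a + pull j b = m" if "a + b = push j m" for a b
    proof -
      have "push j (pull j a + pull j b) = push j m"
        using *[OF that] that by (simp add: push_add push_pull)
      then show ?thesis by simp
    qed
    then show "(\<lambda>(a, b). (pull j a, pull j b)) ` {(a, b). a + b = push j m} \<subseteq> {(a, b). a + b = m}"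
      by auto
  qed (auto simp: pull_push push_add)
  from sum.reindex_bij_betw[OF this, of "\<lambda>p. f (fst p) * g (snd p)"]
  show "shift j (kmul f g) m = kmul (shift j f) (shift j g) m"
    by (simp add: shift_def kmul_def case_prod_unfold)
qed

lemma shift_kprod: "shift j (kprod fs) = kprod (map (shift j) fs)"
  by (induction fs) (simp_all add: kprod_def shift_kone shift_kmul)

section \<open>Quasi-symmetric series as the common fixed points of the shifts\<close>

lemma shift_QSym:
  assumes "f \<in> QSym" shows "shift j f = f"
proof
  fix m
  have "\<forall>m m'. exps m = exps m' \<longrightarrow> f m = f m'"
    using assms unfolding QSym_def mem_Collect_eq by (rule conjunct2)
  then have "f (push j m) = f m" using exps_push[of j m] by (elim allE impE)
  then show "shift j f m = f m" unfolding shift_def .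
qed

lemma push_compress:
  "\<exists>m0 k. keys m0 = {..<k} \<and> exps m0 = exps m \<and> (\<forall>g. (\<forall>j. shift j g = g) \<longrightarrow> g m0 = g m)"
proof (induction "\<Sum>(keys m)" arbitrary: m rule: less_induct)
  case less
  show ?case
  proof (cases "\<exists>i j. i \<in> keys m \<and> j \<notin> keys m \<and> j < i")
    case True
    then obtain i j where ij: "i \<in> keys m" "j \<notin> keys m" "j < i" by blast
    define m' where "m' = pull j m"
    have m: "m = push j m'" using ij by (simp add: m'_def push_pull)
    obtain i' where i': "i' \<in> keys m'" "i = skip j i'" using ij(1) unfolding m keys_push by auto
    have "\<Sum>(keys m) = sum (skip j) (keys m')"
      unfolding m keys_push by (simp add: sum.reindex inj_on_subset[OF inj_skip])
    \<comment> \<open>\<open>skip j\<close> never lowers an index and strictly raises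
      \<open>i'\<close>, whose image i lies above the gap.\<close>
    moreover have "\<Sum>(keys m') < sum (skip j) (keys m')"
      using i' ij(3) by (intro sum_strict_mono_ex1) (auto simp: skip_def split: if_splits intro!: bexI[of _ i'])
    ultimately have "\<Sum>(keys m') < \<Sum>(keys m)" by simp
    from less[OF this] obtain m0 k where *: "keys m0 = {..<k}" "exps m0 = exps m'"
      "\<And>g. (\<forall>j. shift j g = g) \<Longrightarrow> g m0 = g m'" by blast
    have "g m' = g m" if "\<forall>j. shift j g = g" for g
      using that unfolding m shift_def by metis
    then show ?thesis using * exps_push[of j m'] m by metis
  next
    case False
    have "\<exists>k. k \<notin> keys m" using ex_new_if_finite[of "keys m"] by auto
    then have k: "(LEAST k. k \<notin> keys m) \<notin> keys m" by (rule LeastI_ex)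
    have "keys m = {..<LEAST k. k \<notin> keys m}"
    proof (intro equalityI subsetI)
      fix i assume "i \<in> keys m"
      then show "i \<in> {..<LEAST k. k \<notin> keys m}" using k False
        by (metis lessThan_iff linorder_neqE_nat)
    qed (use not_less_Least in blast)
    then show ?thesis by blast
  qed
qed

lemma exps_inj_initial:
  assumes "keys m = {..<k}" "keys m' = {..<k'}" "exps m = exps m'"
  shows "m = m'"
proof -
  have eq: "map (lookup m) [0..<k] = map (lookup m') [0..<k']"
    using assms unfolding exps_def by (simp add: lessThan_atLeast0 del: map_eq_conv)
  from arg_cong[OF this, of length] have "k = k'" by simp
  show ?thesis
  proof (rule poly_mapping_eqI)
    fix i
    show "lookup m i = lookup m' i"
    proof (cases "i < k")
      case True
      then show ?thesis using eq \<open>k = k'\<close> by simp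
    next
      case False
      then have "i \<notin> keys m" "i \<notin> keys m'" using assms \<open>k = k'\<close> by auto
      then show ?thesis by (simp add: in_keys_iff)
    qed
  qed
qed

text \<open>Monomials with equal exponent lists compress to the same gap-free monomial.\<close>

lemma QSym_of_shift:
  assumes "g \<in> K" "\<And>j. shift j g = g" shows "g \<in> QSym"
proof -
  have "g m = g m'" if eq: "exps m = exps m'" for m m'
  proof -
    obtain m0 k where m0: "keys m0 = {..<k}" "exps m0 = exps m" "g m0 = g m"
      using push_compress[of m] assms(2) by blast
    obtain m1 k' where m1: "keys m1 = {..<k'}" "exps m1 = exps m'" "g m1 = g m'"
      using push_compress[of m'] assms(2) by blast
    have "m0 = m1" by (rule exps_inj_initial[OF m0(1) m1(1)]) (simp add: m0(2) m1(2) eq)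
    then show ?thesis using m0 m1 by simp
  qed
  then show ?thesis using assms(1) unfolding QSym_def by blast
qed

section \<open>Action of the shifts on the factors\<close>

lemma eventually_trunc_neq:
  assumes "f \<in> K" "g \<in> K" "f \<noteq> g"
  shows "\<forall>\<^sub>F n in sequentially. trunc n f \<noteq> trunc n g"
proof -
  obtain m where m: "f m \<noteq> g m" using assms(3) by auto
  obtain N where N: "keys m \<subseteq> {..<N}" by (rule keys_subset_bound[of 0 m])
  have "trunc n f \<noteq> trunc n g" if "n \<ge> N" for n
  proof -
    have "keys m \<subseteq> {..<n}" using N that by auto
    then have "lookup (trunc n f) m \<noteq> lookup (trunc n g) m" using m assms by (simp add: lookup_trunc)
    then show ?thesis by auto
  qed
  then show ?thesis by (auto simp: eventually_sequentially)
qed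

text \<open>A monomial separating g from h is untouched by \<open>push j\<close> as soon as j
  exceeds all its variables.\<close>

lemma eventually_shift_neq:
  assumes "g \<noteq> h" shows "\<forall>\<^sub>F j in sequentially. shift j g \<noteq> h"
proof -
  obtain m where m: "g m \<noteq> h m" using assms by auto
  obtain N where N: "keys m \<subseteq> {..<N}" by (rule keys_subset_bound[of 0 m])
  have "shift j g \<noteq> h" if "j \<ge> N" for j
  proof -
    have "keys m \<subseteq> {..<j}" using N that by auto
    then have "shift j g m = g m" by (simp add: shift_def push_id)
    then show ?thesis using m by auto
  qed
  then show ?thesis by (auto simp: eventually_sequentially)
qed

text \<open>The last clause serves irreducible constants such as prime numbers: equality of degrees
  cannot tell them from units, but a shift fixes them.\<close>

lemma eventually_shift_factor:
  assumes "K_irreducible g"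
  shows "\<forall>\<^sub>F n in sequentially. rprime (polys_below n) (trunc n g) \<and>
    tdeg (trunc n (shift j g)) \<le> tdeg (trunc n g) \<and>
    (tdeg (trunc n g) = 0 \<longrightarrow> shift j g = g)"
proof -
  have gK: "g \<in> K" using assms by (simp add: K_irreducible_def)
  obtain N1 where N1: "\<And>n. n \<ge> N1 \<Longrightarrow> rprime (polys_below n) (trunc n g)"
    using K_irreducible_eventually_rprime[OF assms] by blast
  obtain N2 d where N2: "\<And>n. n \<ge> N2 \<Longrightarrow> tdeg (trunc n g) = d" and d: "\<And>m. g m \<noteq> 0 \<Longrightarrow> mdeg m \<le> d"
    using tdeg_trunc_stable[OF gK] by blast
  have "tdeg (trunc n (shift j g)) \<le> d" for n
    using shift_bound[of g d j, OF d] gK shift_in_K by (auto simp: tdeg_le_iff lookup_trunc)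
  moreover have "shift j g = g" if "d = 0"
  proof
    fix m
    show "shift j g m = g m"
    proof (cases "m = 0")
      case False
      then have "\<not> mdeg m \<le> d" using that by (simp add: mdeg_eq_0_iff)
      then have "g m = 0" "shift j g m = 0" using d shift_bound[of g d j m, OF d] by blast+
      then show ?thesis by simp
    qed (simp add: shift_def)
  qed
  ultimately show ?thesis
    unfolding eventually_sequentially using N1 N2 by (intro exI[of _ "max N1 N2"]) auto
qed

text \<open>Otherwise all large truncations would separate g from every shifted factor and its
  negative, whereas unique factorization at one such level identifies g with one of them up to
  sign.\<close>

lemma shift_permutes_factors:
  assumes f: "shift j (kprod fs) = kprod fs" and irr: "\<forall>g\<in>set fs. K_irreducible g"
    and g: "g \<in> set fs"
  shows "\<exists>h\<in>set fs. g = shift j h \<or> g = - shift j h"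
proof (rule ccontr)
  assume no: "\<not> ?thesis"
  have fsK: "set fs \<subseteq> K" using irr by (auto simp: K_irreducible_def)
  have uK: "- x \<in> K" if "x \<in> K" for x using that by (auto simp: K_def)
  have "\<forall>\<^sub>F n in sequentially. \<forall>h\<in>set fs. trunc n g \<noteq> trunc n (shift j h) \<and>
      trunc n g \<noteq> trunc n (- shift j h)"
  proof (intro eventually_ball_finite ballI)
    fix h assume h: "h \<in> set fs"
    then have K: "g \<in> K" "shift j h \<in> K" using g fsK shift_in_K by blast+
    have "g \<noteq> shift j h" "g \<noteq> - shift j h" using no h by blast+
    then show "\<forall>\<^sub>F n in sequentially. trunc n g \<noteq> trunc n (shift j h) \<and>
      trunc n g \<noteq> trunc n (- shift j h)"
      using eventually_trunc_neq[OF K(1) K(2)] eventually_trunc_neq[OF K(1) uK[OF K(2)]]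
      by (intro eventually_conj) blast+
  qed simp
  moreover have "\<forall>\<^sub>F n in sequentially. \<forall>h\<in>set fs. rprime (polys_below n) (trunc n h) \<and>
    tdeg (trunc n (shift j h)) \<le> tdeg (trunc n h) \<and>
    (tdeg (trunc n h) = 0 \<longrightarrow> shift j h = h)"
    using irr by (intro eventually_ball_finite ballI eventually_shift_factor) auto
  \<comment> \<open>The finitely many requirements hold together for all large n, so the
    contradiction can be derived at a single level.\<close>
  ultimately have "\<forall>\<^sub>F n in sequentially. False"
  proof eventually_elim
    case (elim n)
    interpret subdomain "polys_below n" by (rule subdomain_polys_below)
    let ?\<phi> = "\<lambda>h. trunc n (shift j h)"
    have prod: "prod_list (map ?\<phi> fs) = prod_list (map (trunc n) fs)"
    proof -
      have "set (map (shift j) fs) \<subseteq> K" using fsK shift_in_K by auto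
      from trunc_kprod[OF this, of n] show ?thesis
        using f fsK by (simp add: trunc_kprod o_def flip: shift_kprod)
    qed
    have nz: "prod_list (map (trunc n) fs) \<noteq> 0"
    proof
      assume "prod_list (map (trunc n) fs) = 0"
      then obtain h where "h \<in> set fs" "trunc n h = 0" by (auto simp: prod_list_zero_iff)
      then show False using elim(2) unfolding rprime_def by blast
    qed
    have deg: "tdeg (?\<phi> h) = tdeg (trunc n h)" if "h \<in> set fs" for h
    proof (rule tdeg_eq_of_prod_list[OF _ nz _ _ that])
      show "prod_list (map ?\<phi> fs) \<noteq> 0" using nz prod by simp
      show "tdeg (prod_list (map ?\<phi> fs)) = tdeg (prod_list (map (trunc n) fs))" by (simp only: prod)
      show "tdeg (?\<phi> x) \<le> tdeg (trunc n x)" if "x \<in> set fs" for x using elim(2) that by blast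
    qed
    have "\<forall>q\<in>set (map ?\<phi> fs). q \<in> polys_below n \<and> \<not> runit (polys_below n) q"
    proof
      fix q assume "q \<in> set (map ?\<phi> fs)"
      then obtain h where h: "h \<in> set fs" "q = ?\<phi> h" by auto
      have "q \<in> polys_below n" using h fsK by (auto intro: trunc_mem shift_in_K)
      moreover have "\<not> runit (polys_below n) q"
      proof
        \<comment> \<open>A unit has degree 0, so h is a constant fixed by the shift; its truncation
          would be both prime and a unit.\<close>
        assume u: "runit (polys_below n) q"
        then have "tdeg q = 0" by (auto simp: runit_polys_below)
        then have "tdeg (trunc n h) = 0" using deg[OF h(1)] h(2) by simp
        then have "shift j h = h" using h(1) elim(2) by blast
        then have "q = trunc n h" using h(2) by simp
        moreover have "rprime (polys_below n) (trunc n h)" using h(1) elim(2) by blast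
        ultimately show False using u by (simp add: rprime_def)
      qed
      ultimately show "q \<in> polys_below n \<and> \<not> runit (polys_below n) q" ..
    qed
    moreover have "\<forall>p\<in>set (map (trunc n) fs). rprime (polys_below n) p"
      using elim(2) by (simp only: set_map ball_simps) blast
    moreover have "prod_list (map ?\<phi> fs) = 1 * prod_list (map (trunc n) fs)" using prod by simp
    \<comment> \<open>The truncated original factors are the primes and the shifted ones the
      nonunits; both lists have the length of \<open>fs\<close>, so every prime is matched.\<close>
    ultimately have "\<forall>p\<in>set (map (trunc n) fs). \<exists>q\<in>set (map ?\<phi> fs).
        \<exists>v. runit (polys_below n) v \<and> q = v * p"
      using prime_list_match[OF runit_one, of "map (trunc n) fs" "map ?\<phi> fs"] by simp
    then obtain h v where h: "h \<in> set fs" "runit (polys_below n) v" "?\<phi> h = v * trunc n g"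
      using g by auto
    then have "trunc n g = ?\<phi> h \<or> trunc n g = - ?\<phi> h" by (auto simp: runit_polys_below)
    moreover have "trunc n (- shift j h) = - ?\<phi> h"
      using h(1) fsK by (intro trunc_uminus shift_in_K) blast
    ultimately show False using elim(1) h(1) by metis
  qed
  then show False by simp
qed

theorem theorem8p1:
  fixes f :: series and fs :: "series list"
  assumes "f \<in> QSym"
    and "\<forall>g\<in>set fs. K_irreducible g"
    and "f = kprod fs"
  shows "\<forall>g\<in>set fs. g \<in> QSym"
proof
  fix g0 assume g0: "g0 \<in> set fs"
  \<comment> \<open>Factors are matched only up to the units 1 and -1; closing under negation turns
    this into a plain inclusion of \<open>X\<close> in its image.\<close>
  define X where "X = set fs \<union> uminus ` set fs"
  have fin: "finite X" by (simp add: X_def)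
  have sub: "X \<subseteq> shift j ` X" for j
  proof -
    have inv: "shift j (kprod fs) = kprod fs"
      using shift_QSym[OF assms(1)] unfolding assms(3) .
    have neg: "- (- x) = x" for x :: series by (simp add: fun_eq_iff)
    show ?thesis
    proof
      fix x assume "x \<in> X"
      then obtain g where g: "g \<in> set fs" "x = g \<or> x = - g" unfolding X_def by (elim UnE imageE) simp_all
      from shift_permutes_factors[OF inv assms(2) g(1)] obtain h
        where h: "h \<in> set fs" "g = shift j h \<or> g = - shift j h" by (rule bexE)
      have hX: "h \<in> X" "- h \<in> X" unfolding X_def using h(1) by (simp_all only: UnI1 UnI2 imageI)
      from g(2) h(2) have "x = shift j h \<or> x = shift j (- h)"
        unfolding shift_uminus by (elim disjE) (simp_all add: neg)
      then show "x \<in> shift j ` X" by (elim disjE) (simp_all only: imageI hX)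
    qed
  qed
  \<comment> \<open>The image of a finite set has at most as many elements, so the inclusion is an
    equality and each shift is injective on \<open>X\<close>.\<close>
  have surj: "shift j ` X = X" for j
    by (rule card_seteq[OF finite_imageI[OF fin] sub card_image_le[OF fin], symmetric])
  then have inj: "inj_on (shift j) X" for j by (intro eq_card_imp_inj_on[OF fin]) simp
  have "\<forall>\<^sub>F j in sequentially. \<forall>g\<in>X. \<forall>h\<in>X - {g}. shift j g \<noteq> h"
    using fin by (intro eventually_ball_finite ballI eventually_shift_neq) auto
  then obtain J where neq: "\<forall>j\<ge>J. \<forall>g\<in>X. \<forall>h\<in>X - {g}. shift j g \<noteq> h"
    unfolding eventually_sequentially by blast
  have J: "shift j g = g" if "j \<ge> J" "g \<in> X" for j g
  proof (rule ccontr)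
    assume "shift j g \<noteq> g"
    moreover have "shift j g \<in> X" using imageI[OF that(2), of "shift j"] by (simp only: surj)
    ultimately show False using neq that by blast
  qed
  have "\<forall>g\<in>X. shift j g = g" for j
  proof -
    \<comment> \<open>Downward induction starts at \<open>max j J\<close>, where every element of
      \<open>X\<close> is already fixed.\<close>
    have "j \<le> max j J" by simp
    then show ?thesis
    proof (induction rule: inc_induct)
      case base
      then show ?case using J by simp
    next
      case (step i)
      show ?case
      proof
        fix g assume g: "g \<in> X"
        then have "shift (Suc i) g = g" using step.IH by blast
        \<comment> \<open>The elements \<open>shift i g\<close> and g of \<open>X\<close> have the
          same image under \<open>shift i\<close>, so injectivity identifies them.\<close>
        then have "shift i (shift i g) = shift i g" using shift_shift[of i g] by simp
        moreover have "shift i g \<in> X" using imageI[OF g, of "shift i"] by (simp only: surj)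
        ultimately show "shift i g = g" using inj_onD[OF inj _ _ g] by blast
      qed
    qed
  qed
  then have "shift j g0 = g0" for j using g0 by (auto simp: X_def)
  moreover have "g0 \<in> K" using assms(2) g0 by (auto simp: K_irreducible_def)
  ultimately show "g0 \<in> QSym" by (intro QSym_of_shift)
qed

end
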